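(* Let $(Z_t)_{t\ge0}$ be a piecewise-deterministic Markov process (PDMP) on $\mathbb{R}^d$ with vector field $g\in C^1(\mathbb{R}^d,\mathbb{R}^d)$, flow $(\varphi_t)$, continuous intensity function $\lambda:\mathbb{R}^d\to\mathbb{R}_{\ge0}$ and random jump maps $R^\xi$, $\xi\in S$, and let $P_tf(z)=\mathbb{E}_z[f(Z_t)]$ be its Markov semigroup. Assume: (i) $g$ is Lipschitz continuous, i.e. there is $L>0$ with $\|g(x)-g(y)\|\le L\|x-y\|$ for all $x,y\in\mathbb{R}^d$. (ii) One of the following two conditions holds: (1) $\|\lambda\|_\infty<\infty$, and as $\|z\|\to\infty$ one has $\inf_{0\le s\le t}\|\varphi_s(z)\|\to\infty$ for all $t>0$ and $\|R^\xi(z)\|\to\infty$ for all $\xi\in S$; (2) $\|R^\xi(z)\|=\|z\|$ for all $z\in\mathbb{R}^d$ and $\xi\in S$, and for all $t>0$, as $\|z\|\to\infty$, $$\inf\Big\{\big\|[\varphi_{t_k}\circ R^{\xi_k}\circ\cdots\circ R^{\xi_1}\circ\varphi_{t_0}](z)\big\| \;:\; k\in\mathbb{N},\ t_0,\dots,t_k\ge0,\ t_0+\dots+t_k=t,\ \xi_1,\dots,\xi_k\in S\Big\}\to\infty.$$ Then $P_t$ is Feller, i.e. (a) (Feller property) for all $t\ge0$ and $f\in C_0(\mathbb{R}^d)$: $P_tf\in C_0(\mathbb{R}^d)$; (b) (strong continuity) $\lim_{t\to0}\|P_tf-f\|_\infty=0$ for all $f\in C_0(\mathbb{R}^d)$.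
   Context: $\|\cdot\|$ is the Euclidean norm, $\|\cdot\|_\infty$ the supremum norm, $\mathbb{N}=\{0,1,2,\dots\}$. $C_0(\mathbb{R}^d)$ is the space of continuous functions $f:\mathbb{R}^d\to\mathbb{R}$ vanishing at infinity. PDMP on $\mathbb{R}^d$: the data are a Lipschitz vector field $g\in C^1(\mathbb{R}^d,\mathbb{R}^d)$ with flow $\varphi_t$ ($t\mapsto\varphi_t(z)$ solves $\dot x=g(x)$, $x(0)=z$); a continuous intensity $\lambda:\mathbb{R}^d\to\mathbb{R}_{\ge0}$; a probability space $(S,\mathcal{S},\Xi)$; and a (jointly measurable) function $R:\mathbb{R}^d\times S\to\mathbb{R}^d$, $(z,\xi)\mapsto R^\xi(z)$. For $z\in\mathbb{R}^d$ let $\mu_z$ be the law of the waiting time until the next jump, determined by $\mu_z([t,\infty])=\exp(-\int_0^t\lambda(\varphi_s(z))\,ds)$ for $t\ge0$, and let $W:\mathbb{R}^d\times(0,1)\to[0,\infty]$ be such that $W(z,U)\sim\mu_z$ if $U\sim\mathrm{Unif}_{(0,1)}$. Let $U_1,U_2,\dots\sim\mathrm{Unif}_{(0,1)}$ and $\xi_1,\xi_2,\dots\sim\Xi$ be independent. Starting from $z$, set $T_0=0$, $Z_{T_0}=z$ and recursively $T_k=T_{k-1}+W(Z_{T_{k-1}},U_k)$, $Z_{T_k}=R^{\xi_k}(\varphi_{T_k-T_{k-1}}(Z_{T_{k-1}}))$ (no further jump occurs once $T_k=\infty$). With $N_t=\max\{k: T_k\le t\}$, set $Z_t=\varphi_{t-T_{N_t}}(Z_{T_{N_t}})$.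 $\mathbb{E}_z$ denotes expectation for the process started at $z$.
   Formalization: The formal theorem also assumes that at every z with λ(z)>0 the jump map R^ξ is continuous at z for Ξ-almost every ξ; with merely measurable R the claim fails (d=1, g=0, λ=1, R(z)=z if |z| is rational, −z otherwise). *)

theory Defs
  imports "HOL-Probability.Probability"
begin

definition C1_map :: "('a::real_normed_vector \<Rightarrow> 'b::real_normed_vector) \<Rightarrow> bool" where
  "C1_map g \<longleftrightarrow>
     (\<exists>g'. (\<forall>x. (g has_derivative blinfun_apply (g' x)) (at x)) \<and> continuous_on UNIV g')"

definition C0 :: "('a::real_normed_vector \<Rightarrow> real) set" where
  "C0 = {f. continuous_on UNIV f \<and> (f \<longlongrightarrow> 0) at_infinity}"

text \<open>Only nonnegative times occur in the process, so nothing is required of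
  \<open>\<phi> t\<close> for \<open>t < 0\<close>.\<close>

definition is_flow :: "('a::real_normed_vector \<Rightarrow> 'a) \<Rightarrow> (real \<Rightarrow> 'a \<Rightarrow> 'a) \<Rightarrow> bool" where
  "is_flow g \<phi> \<longleftrightarrow>
     (\<forall>z. \<phi> 0 z = z \<and>
          (\<forall>t\<ge>0. ((\<lambda>s. \<phi> s z) has_vector_derivative g (\<phi> t z)) (at t within {0..})))"

text \<open>The case \<open>t = 0\<close> makes the law a probability measure on \<open>[0,\<infinity>]\<close>; it may have an atom
  at \<open>\<infinity>\<close>.\<close>

definition is_waiting_law ::
  "(real \<Rightarrow> 'a \<Rightarrow> 'a) \<Rightarrow> ('a \<Rightarrow> real) \<Rightarrow> 'a \<Rightarrow> ennreal measure \<Rightarrow> bool" where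
  "is_waiting_law \<phi> lam z \<mu> \<longleftrightarrow>
     sets \<mu> = sets borel \<and>
     (\<forall>t\<ge>0. emeasure \<mu> {ennreal t..} = ennreal (exp (- integral {0..t} (\<lambda>s. lam (\<phi> s z)))))"

text \<open>The uniform distribution, with the open interval itself as underlying space.\<close>

definition unif01 :: "real measure" where
  "unif01 = restrict_space lborel {0<..<1}"

text \<open>\<open>pdmp_skeleton \<phi> W R z u x k\<close> is the pair \<open>(T\<^sub>k, Z\<^bsub>T\<^sub>k\<^esub>)\<close> for the start point \<open>z\<close>.  The driving
  sequences are indexed from \<open>0\<close>, so \<open>u k\<close> and \<open>x k\<close> are the values of \<open>U\<^bsub>k+1\<^esub>\<close> and \<open>\<xi>\<^bsub>k+1\<^esub>\<close>.
  Once \<open>T\<^sub>k = \<infinity>\<close> all later jump times are \<open>\<infinity>\<close> too, and the second component is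
  a dummy value that is never used by \<open>pdmp_state\<close>.\<close>

primrec pdmp_skeleton ::
  "(real \<Rightarrow> 'a \<Rightarrow> 'a) \<Rightarrow> ('a \<Rightarrow> real \<Rightarrow> ennreal) \<Rightarrow> ('a \<Rightarrow> 's \<Rightarrow> 'a) \<Rightarrow> 'a \<Rightarrow>
   (nat \<Rightarrow> real) \<Rightarrow> (nat \<Rightarrow> 's) \<Rightarrow> nat \<Rightarrow> ennreal \<times> 'a" where
  "pdmp_skeleton \<phi> W R z u x 0 = (0, z)"
| "pdmp_skeleton \<phi> W R z u x (Suc k) =
     (let (T, y) = pdmp_skeleton \<phi> W R z u x k; w = W y (u k)
      in (T + w, R (\<phi> (enn2real w) y) (x k)))"

text \<open>If infinitely many jumps happen up to time \<open>t\<close>, then \<open>Max\<close> is an unspecified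
  index.\<close>

definition pdmp_state ::
  "(real \<Rightarrow> 'a \<Rightarrow> 'a) \<Rightarrow> ('a \<Rightarrow> real \<Rightarrow> ennreal) \<Rightarrow> ('a \<Rightarrow> 's \<Rightarrow> 'a) \<Rightarrow> 'a \<Rightarrow>
   (nat \<Rightarrow> real) \<Rightarrow> (nat \<Rightarrow> 's) \<Rightarrow> real \<Rightarrow> 'a" where
  "pdmp_state \<phi> W R z u x t =
     (let N = Max {k. fst (pdmp_skeleton \<phi> W R z u x k) \<le> ennreal t};
          (T, y) = pdmp_skeleton \<phi> W R z u x N
      in \<phi> (t - enn2real T) y)"

definition pdmp_semigroup ::
  "(real \<Rightarrow> 'a \<Rightarrow> 'a) \<Rightarrow> ('a \<Rightarrow> real \<Rightarrow> ennreal) \<Rightarrow> ('a \<Rightarrow> 's \<Rightarrow> 'a) \<Rightarrow> 'w measure \<Rightarrow>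
   (nat \<Rightarrow> 'w \<Rightarrow> real) \<Rightarrow> (nat \<Rightarrow> 'w \<Rightarrow> 's) \<Rightarrow> real \<Rightarrow> ('a \<Rightarrow> real) \<Rightarrow> 'a \<Rightarrow> real" where
  "pdmp_semigroup \<phi> W R M U X t f z =
     (\<integral>\<omega>. f (pdmp_state \<phi> W R z (\<lambda>k. U k \<omega>) (\<lambda>k. X k \<omega>) t) \<partial>M)"

text \<open>\<open>pdmp_path \<phi> R \<tau> \<xi> k\<close> is the map
  \<open>\<phi>\<^bsub>\<tau> k\<^esub> \<circ> R\<^bsup>\<xi> k\<^esup> \<circ> \<dots> \<circ> R\<^bsup>\<xi> 1\<^esup> \<circ> \<phi>\<^bsub>\<tau> 0\<^esub>\<close>; the value \<open>\<xi> 0\<close> is not used.\<close>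

primrec pdmp_path ::
  "(real \<Rightarrow> 'a \<Rightarrow> 'a) \<Rightarrow> ('a \<Rightarrow> 's \<Rightarrow> 'a) \<Rightarrow> (nat \<Rightarrow> real) \<Rightarrow> (nat \<Rightarrow> 's) \<Rightarrow> nat \<Rightarrow> 'a \<Rightarrow> 'a" where
  "pdmp_path \<phi> R \<tau> \<xi> 0 z = \<phi> (\<tau> 0) z"
| "pdmp_path \<phi> R \<tau> \<xi> (Suc k) z = \<phi> (\<tau> (Suc k)) (R (pdmp_path \<phi> R \<tau> \<xi> k z) (\<xi> (Suc k)))"

definition bounded_rate_condition ::
  "(real \<Rightarrow> 'a::real_normed_vector \<Rightarrow> 'a) \<Rightarrow> ('a \<Rightarrow> real) \<Rightarrow> 's set \<Rightarrow> ('a \<Rightarrow> 's \<Rightarrow> 'a) \<Rightarrow> bool" where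
  "bounded_rate_condition \<phi> lam S R \<longleftrightarrow>
     bounded (range lam) \<and>
     (\<forall>t>0. filterlim (\<lambda>z. INF s\<in>{0..t}. norm (\<phi> s z)) at_top at_infinity) \<and>
     (\<forall>\<xi>\<in>S. filterlim (\<lambda>z. norm (R z \<xi>)) at_top at_infinity)"

definition norm_preserving_condition ::
  "(real \<Rightarrow> 'a::real_normed_vector \<Rightarrow> 'a) \<Rightarrow> 's set \<Rightarrow> ('a \<Rightarrow> 's \<Rightarrow> 'a) \<Rightarrow> bool" where
  "norm_preserving_condition \<phi> S R \<longleftrightarrow>
     (\<forall>z. \<forall>\<xi>\<in>S. norm (R z \<xi>) = norm z) \<and>
     (\<forall>t>0. filterlim
        (\<lambda>z. Inf {norm (pdmp_path \<phi> R \<tau> \<xi> k z) | k \<tau> \<xi>.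
               (\<forall>i\<le>k. 0 \<le> \<tau> i) \<and> (\<Sum>i\<le>k. \<tau> i) = t \<and> (\<forall>i\<in>{1..k}. \<xi> i \<in> S)})
        at_top at_infinity)"

end

theory Submission
  imports Defs
begin

text \<open>
  The function \<open>W\<close> that generates the waiting times is prescribed only up to its law, so paths
  need not depend continuously on the start point and the proof works with expectations instead.
  Conditioning on the first jump, \<open>P\<^sub>t f(z)\<close> is \<open>f\<close> at the end of the undisturbed orbit, weighted
  by the probability of no jump, plus an integral over the time \<open>s\<close> of the first jump, with density
  \<open>lam(\<phi>\<^sub>s z) exp(- \<Lambda>\<^sub>s(z))\<close>, of the expectation restarted with remaining time \<open>t - s\<close>. Cutting the
  process off at the \<open>n\<close>-th jump turns this into a recursion (\<open>truncated_expectation_Suc\<close>), and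
  each property of the semigroup is first obtained for the truncations by induction.

  Continuity in \<open>z\<close> follows by dominated convergence (\<open>truncated_expectation_tendsto\<close>): where the
  rate is positive, almost every jump map is continuous, and where it vanishes, so does the density.
  The truncation error is controlled by the probability of \<open>n\<close> jumps up to time \<open>t\<close>, which is at most
  \<open>(B t)\<^sup>n / n!\<close> as long as the process only meets rates up to \<open>B\<close> (\<open>many_jumps_le\<close>). If the rate is
  bounded, such a \<open>B\<close> is global. If the jumps preserve the norm, the linear growth of the vector field
  confines the process started in a ball to a larger ball during a bounded time, whatever the jumps
  are, and the rate is bounded there. In both cases the truncations converge
  uniformly on balls and the limit is continuous.

  Decay at infinity differs between the two cases. For a bounded rate the recursion preserves decay and
  the truncations converge uniformly on the whole space. For norm-preserving jumps all states that can
  be reached are far out if the start point is (\<open>reachable_far_out\<close>). For strong continuity, far out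
  the same arguments work uniformly over short times; on a ball, a jump in a short time is unlikely
  (\<open>transition_near_flow\<close>), and the flow moves points of a compact set little.
\<close>

section \<open>Gronwall estimates and the flow of a Lipschitz field\<close>

text \<open>The factor \<open>exp (- K s)\<close> turns the differential inequality into monotonicity, which
  avoids integral inequalities altogether.\<close>

lemma gronwall_within:
  fixes v D :: "real \<Rightarrow> real"
  assumes der: "\<And>s. 0 \<le> s \<Longrightarrow> (v has_real_derivative D s) (at s within {0..})"
    and bound: "\<And>s. 0 \<le> s \<Longrightarrow> D s \<le> K * v s"
    and st: "0 \<le> s" "s \<le> t"
  shows "v t \<le> exp (K * (t - s)) * v s"
proof -
  define w where "w = (\<lambda>s. exp (- K * s) * v s)"
  have w_der: "(w has_real_derivative exp (- K * r) * (D r - K * v r)) (at r within {0..})"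
    if "0 \<le> r" for r
    unfolding w_def by (auto intro!: derivative_eq_intros der that simp: algebra_simps)
  have "w t \<le> w s"
  proof (rule DERIV_nonpos_imp_decreasing_open[OF st(2)])
    fix r assume r: "s < r" "r < t"
    then have "at r within {0..} = at r"
      using st by (intro at_within_interior) auto
    then show "\<exists>y. (w has_real_derivative y) (at r) \<and> y \<le> 0"
      using w_der[of r] bound[of r] r st by (auto simp: mult_le_0_iff)
  next
    have "continuous_on {0..} w"
      by (rule DERIV_continuous_on[OF w_der]) auto
    then show "continuous_on {s..t} w"
      by (rule continuous_on_subset) (use st in auto)
  qed
  then have "exp (K * t) * (exp (- K * t) * v t) \<le> exp (K * t) * (exp (- K * s) * v s)"
    unfolding w_def by (intro mult_left_mono) auto
  moreover have "exp (K * t) * (exp (- K * t) * v t) = v t"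
    by (simp only: mult.assoc[symmetric] exp_add[symmetric]) simp
  moreover have "exp (K * t) * (exp (- K * s) * v s) = exp (K * (t - s)) * v s"
    by (simp only: mult.assoc[symmetric] exp_add[symmetric]) (simp add: algebra_simps)
  ultimately show ?thesis by argo
qed

lemma has_real_derivative_norm_square:
  fixes h :: "real \<Rightarrow> 'a::real_inner"
  assumes "(h has_vector_derivative h') (at s within S)"
  shows "((\<lambda>s. (norm (h s))\<^sup>2) has_real_derivative 2 * (h s \<bullet> h')) (at s within S)"
proof -
  have "((\<lambda>s. h s \<bullet> h s) has_derivative (\<lambda>x. h s \<bullet> (x *\<^sub>R h') + (x *\<^sub>R h') \<bullet> h s)) (at s within S)"
    using assms unfolding has_vector_derivative_def by (intro has_derivative_inner)
  then show ?thesis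
    unfolding has_field_derivative_def power2_norm_eq_inner
    by (rule has_derivative_eq_rhs) (auto simp: fun_eq_iff inner_commute)
qed

locale lipschitz_flow =
  fixes g :: "'a::euclidean_space \<Rightarrow> 'a" and \<phi> :: "real \<Rightarrow> 'a \<Rightarrow> 'a" and L :: real
  assumes flow: "is_flow g \<phi>"
    and L_pos: "L > 0"
    and lipschitz: "\<And>x y. norm (g x - g y) \<le> L * norm (x - y)"
begin

lemma flow_0 [simp]: "\<phi> 0 z = z"
  using flow unfolding is_flow_def by blast

lemma flow_vector_derivative:
  "0 \<le> t \<Longrightarrow> ((\<lambda>s. \<phi> s z) has_vector_derivative g (\<phi> t z)) (at t within {0..})"
  using flow unfolding is_flow_def by blast

lemma flow_dist_le:
  assumes "0 \<le> t"
  shows "norm (\<phi> t z - \<phi> t y) \<le> exp (L * t) * norm (z - y)"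
proof -
  have "(norm (\<phi> t z - \<phi> t y))\<^sup>2 \<le> exp (2 * L * (t - 0)) * (norm (\<phi> 0 z - \<phi> 0 y))\<^sup>2"
  proof (rule gronwall_within[where v = "\<lambda>s. (norm (\<phi> s z - \<phi> s y))\<^sup>2"])
    show "((\<lambda>s. (norm (\<phi> s z - \<phi> s y))\<^sup>2) has_real_derivative
        2 * ((\<phi> s z - \<phi> s y) \<bullet> (g (\<phi> s z) - g (\<phi> s y)))) (at s within {0..})" if "0 \<le> s" for s
      by (intro has_real_derivative_norm_square has_vector_derivative_diff flow_vector_derivative that)
    show "2 * ((\<phi> s z - \<phi> s y) \<bullet> (g (\<phi> s z) - g (\<phi> s y))) \<le> 2 * L * (norm (\<phi> s z - \<phi> s y))\<^sup>2" for s
    proof -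
      have "(\<phi> s z - \<phi> s y) \<bullet> (g (\<phi> s z) - g (\<phi> s y))
          \<le> norm (\<phi> s z - \<phi> s y) * norm (g (\<phi> s z) - g (\<phi> s y))"
        by (rule norm_cauchy_schwarz)
      also have "\<dots> \<le> norm (\<phi> s z - \<phi> s y) * (L * norm (\<phi> s z - \<phi> s y))"
        by (intro mult_left_mono lipschitz) auto
      finally show ?thesis by (simp add: power2_eq_square algebra_simps)
    qed
  qed (use assms in auto)
  also have "\<dots> = (exp (L * t) * norm (z - y))\<^sup>2"
    by (simp add: power_mult_distrib exp_double[symmetric] mult.assoc)
  finally show ?thesis
    by (rule power2_le_imp_le) simp
qed

text \<open>The squared norm is shifted so that it satisfies a homogeneous differential inequality along the
  flow; norm-preserving jumps leave it unchanged.\<close>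

definition energy :: "'a \<Rightarrow> real" where
  "energy z = (norm z)\<^sup>2 + (norm (g 0))\<^sup>2"

definition growth_rate :: real where
  "growth_rate = 2 * L + 1"

lemma growth_rate_pos: "growth_rate > 0"
  using L_pos by (simp add: growth_rate_def)

lemma energy_nonneg: "0 \<le> energy z"
  by (simp add: energy_def)

lemma energy_flow_le:
  assumes "0 \<le> s" "s \<le> t"
  shows "energy (\<phi> t z) \<le> exp (growth_rate * (t - s)) * energy (\<phi> s z)"
proof (rule gronwall_within[where v = "\<lambda>s. energy (\<phi> s z)"])
  show "((\<lambda>s. energy (\<phi> s z)) has_real_derivative 2 * (\<phi> s z \<bullet> g (\<phi> s z))) (at s within {0..})"
    if "0 \<le> s" for s
    unfolding energy_def
    using DERIV_add[OF has_real_derivative_norm_square[OF flow_vector_derivative[OF that]] DERIV_const]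
    by simp
  show "2 * (\<phi> s z \<bullet> g (\<phi> s z)) \<le> growth_rate * energy (\<phi> s z)" for s
  proof -
    define x where "x = \<phi> s z"
    have "norm (g x) \<le> norm (g 0) + L * norm x"
      using lipschitz[of x 0] norm_triangle_sub[of "g x" "g 0"] by simp
    then have "norm x * norm (g x) \<le> norm x * (norm (g 0) + L * norm x)"
      by (intro mult_left_mono) auto
    then have "2 * (x \<bullet> g x) \<le> 2 * norm x * norm (g 0) + 2 * L * (norm x)\<^sup>2"
      using norm_cauchy_schwarz[of x "g x"] by (simp add: power2_eq_square algebra_simps)
    also have "\<dots> \<le> (norm x)\<^sup>2 + (norm (g 0))\<^sup>2 + 2 * L * (norm x)\<^sup>2"
      using sum_squares_bound[of "norm x" "norm (g 0)"] by simp
    also have "\<dots> \<le> growth_rate * energy x"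
      using L_pos by (simp add: growth_rate_def energy_def algebra_simps)
    finally show ?thesis by (simp add: x_def)
  qed
qed (use assms in auto)

lemma continuous_on_flow_time: "continuous_on {0..} (\<lambda>s. \<phi> s z)"
  unfolding continuous_on_eq_continuous_within
  by (auto intro: has_vector_derivative_continuous flow_vector_derivative)

text \<open>Continuity in time for each start point and the Lipschitz bound in the start point, which is
  uniform on bounded time intervals, combine to joint continuity.\<close>

lemma continuous_on_flow: "continuous_on ({0..} \<times> UNIV) (\<lambda>(t, z). \<phi> t z)"
  unfolding continuous_on_def
proof (safe, clarsimp)
  fix t :: real and z :: 'a assume t: "0 \<le> t"
  let ?F = "at (t, z) within {0..} \<times> UNIV"
  have fst_t: "(fst \<longlongrightarrow> t) ?F" and snd_z: "(snd \<longlongrightarrow> z) ?F"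
    using tendsto_fst[OF tendsto_ident_at[of "(t, z)"]] tendsto_snd[OF tendsto_ident_at[of "(t, z)"]] by auto
  have nonneg: "eventually (\<lambda>p. fst p \<in> {0..}) ?F"
    unfolding eventually_at_filter by (rule always_eventually) auto
  have time: "((\<lambda>p. \<phi> (fst p) z) \<longlongrightarrow> \<phi> t z) ?F"
    by (rule continuous_on_tendsto_compose[OF continuous_on_flow_time fst_t])
      (use t nonneg in auto)
  have "((\<lambda>p. \<phi> (fst p) (snd p) - \<phi> (fst p) z) \<longlongrightarrow> 0) ?F"
  proof (rule Lim_null_comparison)
    show "eventually (\<lambda>p. norm (\<phi> (fst p) (snd p) - \<phi> (fst p) z)
        \<le> exp (L * fst p) * norm (snd p - z)) ?F"
      using nonneg by eventually_elim (use flow_dist_le in auto)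
    have "((\<lambda>p. exp (L * fst p) * norm (snd p - z)) \<longlongrightarrow> exp (L * t) * norm (z - z)) ?F"
      by (intro tendsto_intros fst_t snd_z)
    then show "((\<lambda>p. exp (L * fst p) * norm (snd p - z)) \<longlongrightarrow> 0) ?F" by simp
  qed
  from tendsto_add[OF this time] show "((\<lambda>(t, z). \<phi> t z) \<longlongrightarrow> \<phi> t z) ?F"
    by (simp add: case_prod_unfold)
qed

lemma continuous_on_flow_space: "0 \<le> t \<Longrightarrow> continuous_on UNIV (\<phi> t)"
  using continuous_on_compose2[OF continuous_on_flow, of UNIV "\<lambda>z. (t, z)"]
  by (simp add: continuous_on_Pair continuous_on_const continuous_on_id image_subset_iff)

end

section \<open>The density of the waiting time\<close>

text \<open>A law on \<open>[0,\<infinity>]\<close> whose survival function is the exponential of a cumulated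
  rate. The mass at \<open>\<infinity>\<close> is positive exactly if the cumulated rate stays bounded.\<close>

locale waiting_law =
  fixes \<mu> :: "ennreal measure" and a :: "real \<Rightarrow> real"
  assumes sets_\<mu>: "sets \<mu> = sets borel"
    and tail_closed: "\<And>t. 0 \<le> t \<Longrightarrow> emeasure \<mu> {ennreal t..} = ennreal (exp (- integral {0..t} a))"
    and rate_continuous: "continuous_on {0..} a"
    and rate_nonneg: "\<And>s. 0 \<le> s \<Longrightarrow> 0 \<le> a s"
begin

abbreviation "A t \<equiv> integral {0..t} a"

lemma space_\<mu>: "space \<mu> = UNIV"
  using sets_eq_imp_space_eq[OF sets_\<mu>] by simp

lemma rate_continuous_Icc: "0 \<le> r \<Longrightarrow> continuous_on {r..t} a"
  by (rule continuous_on_subset[OF rate_continuous]) auto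

lemma cumulated_rate_derivative:
  assumes "0 \<le> s" "s \<le> t"
  shows "(A has_real_derivative a s) (at s within {0..t})"
  using integral_has_real_derivative[OF rate_continuous_Icc, of 0 s t] assms by simp

lemma cumulated_rate_continuous: "continuous_on {0..t} A"
  by (rule DERIV_continuous_on[OF cumulated_rate_derivative]) auto

lemma prob_space_waiting_law: "prob_space \<mu>"
proof
  have "{ennreal 0..} = UNIV" by auto
  then show "emeasure \<mu> (space \<mu>) = 1"
    using tail_closed[of 0] by (simp add: space_\<mu>)
qed

text \<open>A jump at time \<open>t\<close> itself counts as having happened by time \<open>t\<close>, so the
  event of no jump is \<open>t < w\<close>. It has the same probability as \<open>t \<le> w\<close>
  because the cumulated rate is continuous.\<close>

lemma tail_open:
  assumes t: "0 \<le> t"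
  shows "emeasure \<mu> {ennreal t<..} = ennreal (exp (- A t))"
proof -
  define r where "r = (\<lambda>n. t + 1 / Suc n)"
  have r_lim: "r \<longlonglongrightarrow> t"
    using tendsto_add[OF tendsto_const LIMSEQ_Suc[OF lim_const_over_n, of 1], of t]
    by (simp add: r_def)
  have r_bounds: "t < r n" "r n \<le> t + 1" for n
    by (auto simp: r_def)
  have un: "{ennreal t<..} = (\<Union>n. {ennreal (r n)..})"
  proof (intro set_eqI iffI)
    fix w assume "w \<in> {ennreal t<..}"
    then have w: "ennreal t < w" by simp
    show "w \<in> (\<Union>n. {ennreal (r n)..})"
    proof (cases w)
      case (real x)
      then have "t < x" using w t by (simp add: ennreal_less_iff)
      from order_tendstoD(2)[OF r_lim this] obtain n where "r n < x"
        by (auto simp: eventually_sequentially)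
      then show ?thesis using real by (auto intro!: exI[of _ n] ennreal_leI)
    qed auto
  next
    fix w assume "w \<in> (\<Union>n. {ennreal (r n)..})"
    then obtain n where "ennreal (r n) \<le> w" by auto
    moreover have "ennreal t < ennreal (r n)"
      using r_bounds[of n] t by (simp add: ennreal_less_iff)
    ultimately show "w \<in> {ennreal t<..}" by simp
  qed
  have "(\<lambda>n. emeasure \<mu> {ennreal (r n)..}) \<longlonglongrightarrow> emeasure \<mu> (\<Union>n. {ennreal (r n)..})"
  proof (rule Lim_emeasure_incseq)
    show "incseq (\<lambda>n. {ennreal (r n)..})"
    proof (rule incseq_SucI)
      fix n
      have "ennreal (r (Suc n)) \<le> ennreal (r n)"
        by (intro ennreal_leI) (auto simp: r_def intro!: divide_left_mono)
      then show "{ennreal (r n)..} \<subseteq> {ennreal (r (Suc n))..}" by auto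
    qed
  qed (auto simp: sets_\<mu>)
  moreover have "(\<lambda>n. emeasure \<mu> {ennreal (r n)..}) \<longlonglongrightarrow> ennreal (exp (- A t))"
  proof -
    have "(\<lambda>n. A (r n)) \<longlonglongrightarrow> A t"
      by (rule continuous_on_tendsto_compose[OF cumulated_rate_continuous[of "t + 1"] r_lim])
        (use r_bounds t in \<open>auto intro!: always_eventually intro: less_imp_le[OF le_less_trans]\<close>)
    then have "(\<lambda>n. ennreal (exp (- A (r n)))) \<longlonglongrightarrow> ennreal (exp (- A t))"
      by (intro tendsto_intros)
    moreover have "emeasure \<mu> {ennreal (r n)..} = ennreal (exp (- A (r n)))" for n
      using r_bounds(1)[of n] t by (intro tail_closed) simp
    ultimately show ?thesis by simp
  qed
  ultimately show ?thesis unfolding un by (rule LIMSEQ_unique)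
qed

text \<open>The density is cut at the horizon \<open>t\<close>, so that an atom at \<open>\<infinity>\<close>
  stays outside the range in which the law is compared with Lebesgue measure.\<close>

definition density_before :: "real \<Rightarrow> real \<Rightarrow> real" where
  "density_before t s = indicator {0..t} s * (a s * exp (- A s))"

lemma density_before_nonneg: "0 \<le> density_before t s"
  by (auto simp: density_before_def rate_nonneg split: split_indicator)

lemma density_before_measurable [measurable]: "density_before t \<in> borel_measurable borel"
proof -
  have "(\<lambda>s. indicator {0..t} s *\<^sub>R (a s * exp (- A s))) \<in> borel_measurable borel"
    by (intro borel_measurable_continuous_on_indicator continuous_intros
        cumulated_rate_continuous rate_continuous_Icc) auto
  then show ?thesis by (simp add: density_before_def[abs_def])
qed

lemma nn_integral_density_before:
  assumes "0 \<le> m" "m \<le> t"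
  shows "(\<integral>\<^sup>+ s. ennreal (density_before t s) * indicator {m..} s \<partial>lborel)
    = ennreal (exp (- A m) - exp (- A t))"
proof -
  have "((\<lambda>s. a s * exp (- A s)) has_integral (- exp (- A t)) - (- exp (- A m))) {m..t}"
  proof (rule fundamental_theorem_of_calculus[OF assms(2)])
    fix s assume s: "s \<in> {m..t}"
    have "(A has_real_derivative a s) (at s within {m..t})"
      by (rule DERIV_subset[OF cumulated_rate_derivative[of s t]]) (use s assms in auto)
    then show "((\<lambda>s. - exp (- A s)) has_vector_derivative a s * exp (- A s)) (at s within {m..t})"
      unfolding has_real_derivative_iff_has_vector_derivative[symmetric]
      by (auto intro!: derivative_eq_intros)
  qed
  then have "(\<integral>\<^sup>+ s. ennreal (indicator {m..t} s * (a s * exp (- A s))) \<partial>lborel)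
      = ennreal (exp (- A m) - exp (- A t))"
    by (subst nn_integral_has_integral_lebesgue) (use assms rate_nonneg in auto)
  then show ?thesis
    by (rule trans[rotated])
      (intro nn_integral_cong, use assms in \<open>auto simp: density_before_def split: split_indicator\<close>)
qed

lemma waiting_time_density:
  assumes t: "0 \<le> t"
  shows "distr (density \<mu> (\<lambda>w. ennreal (indicator {..ennreal t} w))) borel enn2real
    = density lborel (\<lambda>s. ennreal (density_before t s))" (is "?N1 = ?N2")
proof (rule measure_eqI_lessThan)
  interpret prob_space \<mu> by (rule prob_space_waiting_law)
  note [measurable_cong] = sets_\<mu>
  have interval: "emeasure \<mu> {ennreal m..ennreal t} = ennreal (exp (- A m) - exp (- A t))"
      "emeasure \<mu> {ennreal m<..ennreal t} = ennreal (exp (- A m) - exp (- A t))"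
    if m: "0 \<le> m" "m \<le> t" for m
  proof -
    have "{ennreal m..ennreal t} = {ennreal m..} - {ennreal t<..}"
        "{ennreal m<..ennreal t} = {ennreal m<..} - {ennreal t<..}"
      by auto
    moreover have "ennreal m \<le> ennreal t" using m by (intro ennreal_leI)
    then have "{ennreal t<..} \<subseteq> {ennreal m..}" "{ennreal t<..} \<subseteq> {ennreal m<..}"
      by auto
    ultimately show "emeasure \<mu> {ennreal m..ennreal t} = ennreal (exp (- A m) - exp (- A t))"
      "emeasure \<mu> {ennreal m<..ennreal t} = ennreal (exp (- A m) - exp (- A t))"
      using m t by (simp_all add: emeasure_Diff sets_\<mu> tail_open tail_closed ennreal_minus)
  qed
  have N1: "emeasure ?N1 {x<..} = emeasure \<mu> ({..ennreal t} \<inter> enn2real -` {x<..})" for x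
  proof -
    have preimage: "enn2real -` {x<..} \<in> sets \<mu>"
      using measurable_sets[of enn2real borel borel "{x<..}"] by (simp add: sets_\<mu>)
    have "emeasure ?N1 {x<..}
        = (\<integral>\<^sup>+ w. ennreal (indicator {..ennreal t} w) * indicator (enn2real -` {x<..}) w \<partial>\<mu>)"
      by (subst emeasure_distr, measurable, subst emeasure_density) (simp_all add: space_\<mu> preimage)
    also have "\<dots> = (\<integral>\<^sup>+ w. indicator ({..ennreal t} \<inter> enn2real -` {x<..}) w \<partial>\<mu>)"
      by (intro nn_integral_cong) (simp split: split_indicator)
    also have "\<dots> = emeasure \<mu> ({..ennreal t} \<inter> enn2real -` {x<..})"
      by (intro nn_integral_indicator sets.Int preimage) (simp add: sets_\<mu>)
    finally show ?thesis .
  qed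
  have N2: "emeasure ?N2 {x<..} = (\<integral>\<^sup>+ s. ennreal (density_before t s) * indicator {x<..} s \<partial>lborel)" for x
    by (subst emeasure_density) auto
  show eq: "emeasure ?N1 {x<..} = emeasure ?N2 {x<..}" for x
  proof -
    consider "x < 0" | "0 \<le> x" "x \<le> t" | "t < x" "0 \<le> x" using t by linarith
    then show ?thesis
    proof cases
      case 1
      then have "{..ennreal t} \<inter> enn2real -` {x<..} = {ennreal 0..ennreal t}"
        by (auto simp: less_le_trans[OF _ enn2real_nonneg])
      moreover have "(\<integral>\<^sup>+ s. ennreal (density_before t s) * indicator {x<..} s \<partial>lborel)
          = (\<integral>\<^sup>+ s. ennreal (density_before t s) * indicator {0..} s \<partial>lborel)"
        using 1 by (intro nn_integral_cong) (auto simp: density_before_def split: split_indicator)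
      ultimately show ?thesis
        unfolding N1 N2 by (simp only: interval nn_integral_density_before order_refl t)
    next
      case 2
      have "{..ennreal t} \<inter> enn2real -` {x<..} = {ennreal x<..ennreal t}"
      proof (intro set_eqI iffI)
        fix w assume "w \<in> {..ennreal t} \<inter> enn2real -` {x<..}"
        then show "w \<in> {ennreal x<..ennreal t}"
          using 2 by (cases w) (auto simp: ennreal_less_iff)
      next
        fix w assume "w \<in> {ennreal x<..ennreal t}"
        then show "w \<in> {..ennreal t} \<inter> enn2real -` {x<..}"
          using 2 by (cases w) (auto simp: ennreal_less_iff top_unique)
      qed
      moreover have "(\<integral>\<^sup>+ s. ennreal (density_before t s) * indicator {x<..} s \<partial>lborel)
          = (\<integral>\<^sup>+ s. ennreal (density_before t s) * indicator {x..} s \<partial>lborel)"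
        using AE_lborel_singleton[of x]
        by (intro nn_integral_cong_AE) (auto split: split_indicator)
      ultimately show ?thesis
        unfolding N1 N2 using 2 by (simp only: interval nn_integral_density_before)
    next
      case 3
      have "{..ennreal t} \<inter> enn2real -` {x<..} = {}"
      proof safe
        fix w assume "w \<le> ennreal t" "x < enn2real w"
        then have "enn2real w \<le> t"
          using t by (metis enn2real_ennreal enn2real_mono ennreal_less_top)
        with \<open>x < enn2real w\<close> 3 show "w \<in> {}" by simp
      qed
      moreover have "(\<integral>\<^sup>+ s. ennreal (density_before t s) * indicator {x<..} s \<partial>lborel)
          = (\<integral>\<^sup>+ s. 0 \<partial>(lborel :: real measure))"
        using 3 by (intro nn_integral_cong) (auto simp: density_before_def split: split_indicator)
      ultimately show ?thesis unfolding N1 N2 by simp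
    qed
  qed
  show "emeasure ?N1 {x<..} < \<infinity>" for x
    unfolding N1 by (simp add: emeasure_finite less_top[symmetric])
qed auto

text \<open>The mass beyond \<open>t\<close> contributes a constant and the rest is an integral against a
  Lebesgue density. The right-hand side depends on the rate alone, although the function that
  generates the waiting times may depend on the start point in a discontinuous way. This is what makes
  continuity in the start point accessible.\<close>

lemma integral_waiting_law:
  fixes k :: "real \<Rightarrow> real"
  assumes t: "0 \<le> t" and k [measurable]: "k \<in> borel_measurable borel"
    and bound: "\<And>s. \<bar>k s\<bar> \<le> C"
  shows "(\<integral>w. (if ennreal t < w then c else k (enn2real w)) \<partial>\<mu>)
    = c * exp (- A t) + (\<integral>s. density_before t s * k s \<partial>lborel)"
proof -
  interpret prob_space \<mu> by (rule prob_space_waiting_law)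
  note [measurable_cong] = sets_\<mu>
  have "(\<integral>w. (if ennreal t < w then c else k (enn2real w)) \<partial>\<mu>)
      = (\<integral>w. c * indicator {ennreal t<..} w + indicator {..ennreal t} w * k (enn2real w) \<partial>\<mu>)"
    by (intro Bochner_Integration.integral_cong) (auto split: split_indicator)
  also have "\<dots> = (\<integral>w. c * indicator {ennreal t<..} w \<partial>\<mu>)
      + (\<integral>w. indicator {..ennreal t} w * k (enn2real w) \<partial>\<mu>)"
  proof (rule Bochner_Integration.integral_add)
    show "integrable \<mu> (\<lambda>w. c * indicator {ennreal t<..} w)"
      by (rule integrable_const_bound[where B = "\<bar>c\<bar>"]) (auto split: split_indicator)
    have "0 \<le> C" using bound[of 0] by linarith
    then show "integrable \<mu> (\<lambda>w. indicator {..ennreal t} w * k (enn2real w))"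
      by (intro integrable_const_bound[where B = C]) (auto split: split_indicator intro: bound)
  qed
  also have "(\<integral>w. c * indicator {ennreal t<..} w \<partial>\<mu>) = c * exp (- A t)"
    using tail_open[OF t] by (simp add: space_\<mu> measure_def sets_\<mu>)
  also have "(\<integral>w. indicator {..ennreal t} w * k (enn2real w) \<partial>\<mu>)
      = (\<integral>s. k s \<partial>distr (density \<mu> (\<lambda>w. ennreal (indicator {..ennreal t} w))) borel enn2real)"
    by (subst integral_distr, measurable, subst integral_density) auto
  also have "\<dots> = (\<integral>s. density_before t s * k s \<partial>lborel)"
    unfolding waiting_time_density[OF t]
    by (subst integral_density) (auto simp: density_before_nonneg)
  finally show ?thesis .
qed

end

section \<open>The law of the driving sequence\<close>

lemma Int_stable_preimages: "Int_stable {f -` A \<inter> S | A. A \<in> sets K}"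
proof (rule Int_stableI, safe)
  fix A B assume "A \<in> sets K" "B \<in> sets K"
  then show "\<exists>C. f -` A \<inter> S \<inter> (f -` B \<inter> S) = f -` C \<inter> S \<and> C \<in> sets K"
    by (intro exI[of _ "A \<inter> B"]) auto
qed

text \<open>Grouping the independent family into the pairs \<open>(U k, X k)\<close> gives an i.i.d. sequence,
  so expectations over the given probability space can be computed on an infinite product. There the
  shifted sequence is independent of the first pair, which is the Markov property at the first jump.\<close>

lemma iid_pair_sequence_law:
  fixes U :: "nat \<Rightarrow> 'w \<Rightarrow> 'u" and X :: "nat \<Rightarrow> 'w \<Rightarrow> 'x"
  assumes M: "prob_space M"
    and U [measurable]: "\<And>k. U k \<in> M \<rightarrow>\<^sub>M N" and U_law: "\<And>k. distr M N (U k) = N"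
    and X [measurable]: "\<And>k. X k \<in> M \<rightarrow>\<^sub>M Xi" and X_law: "\<And>k. distr M Xi (X k) = Xi"
    and indep: "prob_space.indep_sets M
         (case_sum (\<lambda>k. {U k -` A \<inter> space M | A. A \<in> sets N})
                   (\<lambda>k. {X k -` A \<inter> space M | A. A \<in> sets Xi})) (UNIV :: (nat + nat) set)"
  shows "distr M (\<Pi>\<^sub>M k\<in>UNIV. N \<Otimes>\<^sub>M Xi) (\<lambda>\<omega> k. (U k \<omega>, X k \<omega>)) = (\<Pi>\<^sub>M k\<in>UNIV. N \<Otimes>\<^sub>M Xi)"
proof -
  interpret prob_space M by fact
  let ?E = "case_sum (\<lambda>k. {U k -` A \<inter> space M | A. A \<in> sets N})
                   (\<lambda>k. {X k -` A \<inter> space M | A. A \<in> sets Xi})"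
  have stable: "Int_stable (?E i)" for i
    by (cases i) (simp_all only: sum.case Int_stable_preimages)
  have pair_law: "distr M (N \<Otimes>\<^sub>M Xi) (\<lambda>\<omega>. (U k \<omega>, X k \<omega>)) = N \<Otimes>\<^sub>M Xi" for k
  proof -
    interpret N: prob_space N
      using prob_space_distr[OF U, of k] by (simp add: U_law)
    interpret Xi: prob_space Xi
      using prob_space_distr[OF X, of k] by (simp add: X_law)
    show ?thesis
    proof (rule pair_measure_eqI[symmetric])
      fix A B assume A [measurable]: "A \<in> sets N" and B [measurable]: "B \<in> sets Xi"
      define a where "a = U k -` A \<inter> space M"
      define b where "b = X k -` B \<inter> space M"
      have "prob (\<Inter>i\<in>{Inl k, Inr k}. case_sum (\<lambda>_. a) (\<lambda>_. b) i)
          = (\<Prod>i\<in>{Inl k, Inr k}. prob (case_sum (\<lambda>_. a) (\<lambda>_. b) i))"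
        by (rule indep_setsD[OF indep]) (auto simp: a_def b_def)
      then have "prob (a \<inter> b) = prob a * prob b" by simp
      moreover have "emeasure N A = emeasure M a" "emeasure Xi B = emeasure M b"
        unfolding a_def b_def using emeasure_distr[OF U A, of k] emeasure_distr[OF X B, of k]
        by (simp_all add: U_law X_law)
      moreover have "emeasure (distr M (N \<Otimes>\<^sub>M Xi) (\<lambda>\<omega>. (U k \<omega>, X k \<omega>))) (A \<times> B) = emeasure M (a \<inter> b)"
        by (subst emeasure_distr) (auto simp: a_def b_def intro!: arg_cong[where f = "emeasure M"])
      ultimately show "emeasure N A * emeasure Xi B
          = emeasure (distr M (N \<Otimes>\<^sub>M Xi) (\<lambda>\<omega>. (U k \<omega>, X k \<omega>))) (A \<times> B)"
        by (simp add: emeasure_eq_measure ennreal_mult)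
    qed (auto intro: N.sigma_finite_measure_axioms Xi.sigma_finite_measure_axioms)
  qed
  have "indep_sets ?E (\<Union>k. {Inl k, Inr k})"
    by (rule indep_sets_mono_index[OF _ indep]) auto
  then have I: "indep_sets (\<lambda>k. sigma_sets (space M) (\<Union>i\<in>{Inl k, Inr k}. ?E i)) UNIV"
    by (rule indep_sets_collect_sigma[where I = "\<lambda>k. {Inl k, Inr k}"])
      (auto simp: disjoint_family_on_def stable)
  have sub: "{(\<lambda>\<omega>. (U k \<omega>, X k \<omega>)) -` A \<inter> space M | A. A \<in> sets (N \<Otimes>\<^sub>M Xi)}
      \<subseteq> sigma_sets (space M) (\<Union>i\<in>{Inl k, Inr k}. ?E i)" for k
  proof -
    let ?S = "sigma (space M) (\<Union>i\<in>{Inl k, Inr k}. ?E i)"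
    have gen: "(\<Union>i\<in>{Inl k, Inr k}. ?E i) \<subseteq> Pow (space M)" by auto
    have "U k \<in> ?S \<rightarrow>\<^sub>M N"
      by (rule measurableI) (use gen measurable_space[OF U] in \<open>auto simp: space_measure_of_conv
          sets_measure_of intro!: sigma_sets.Basic\<close>)
    moreover have "X k \<in> ?S \<rightarrow>\<^sub>M Xi"
      by (rule measurableI) (use gen measurable_space[OF X] in \<open>auto simp: space_measure_of_conv
          sets_measure_of intro!: sigma_sets.Basic\<close>)
    ultimately have "(\<lambda>\<omega>. (U k \<omega>, X k \<omega>)) \<in> ?S \<rightarrow>\<^sub>M N \<Otimes>\<^sub>M Xi" by (rule measurable_Pair)
    from measurable_sets[OF this] show ?thesis
      using gen by (auto simp: space_measure_of_conv sets_measure_of)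
  qed
  have "indep_vars (\<lambda>_. N \<Otimes>\<^sub>M Xi) (\<lambda>k \<omega>. (U k \<omega>, X k \<omega>)) UNIV"
    unfolding indep_vars_def2 using indep_sets_mono_sets[OF I sub] by auto
  then show ?thesis
    by (subst (asm) indep_vars_iff_distr_eq_PiM) (auto simp: pair_law restrict_def)
qed

section \<open>Pathwise first-jump decomposition\<close>

text \<open>The skeleton is defined by appending a jump at the end; the recursion on the first jump requires
  detaching one at the beginning.\<close>

lemma pdmp_skeleton_Suc_shift:
  "pdmp_skeleton \<phi> W R z u x (Suc k) =
     (let w = W z (u 0);
          (T, y) = pdmp_skeleton \<phi> W R (R (\<phi> (enn2real w) z) (x 0)) (\<lambda>k. u (Suc k)) (\<lambda>k. x (Suc k)) k
      in (w + T, y))"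
proof (induction k)
  case (Suc k)
  then show ?case
    by (subst pdmp_skeleton.simps(2)) (simp add: Let_def case_prod_unfold add.assoc del: pdmp_skeleton.simps(2),
        simp add: Let_def case_prod_unfold add.assoc)
qed (simp add: Let_def)

lemma pdmp_jump_times_mono:
  "j \<le> k \<Longrightarrow> fst (pdmp_skeleton \<phi> W R z u x j) \<le> fst (pdmp_skeleton \<phi> W R z u x k)"
  by (rule lift_Suc_mono_le[of "\<lambda>k. fst (pdmp_skeleton \<phi> W R z u x k)"])
    (auto simp: Let_def case_prod_unfold)

lemma finite_jumps_before:
  assumes "ennreal t < fst (pdmp_skeleton \<phi> W R z u x n)"
  shows "finite {k. fst (pdmp_skeleton \<phi> W R z u x k) \<le> ennreal t}"
proof (rule finite_subset)
  show "{k. fst (pdmp_skeleton \<phi> W R z u x k) \<le> ennreal t} \<subseteq> {..n}"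
  proof (rule subsetI)
    fix k assume "k \<in> {k. fst (pdmp_skeleton \<phi> W R z u x k) \<le> ennreal t}"
    then show "k \<in> {..n}"
      using assms pdmp_jump_times_mono[of n k \<phi> W R z u x] by (cases "k \<le> n") auto
  qed
qed simp

lemma ennreal_add_le_iff:
  assumes "0 \<le> r" "r \<le> t"
  shows "ennreal r + T \<le> ennreal t \<longleftrightarrow> T \<le> ennreal (t - r)"
  using assms by (cases T) (auto simp: ennreal_plus[symmetric] top_unique simp del: ennreal_plus)

lemma pdmp_state_before_first_jump:
  assumes "ennreal t < W z (u 0)"
  shows "pdmp_state \<phi> W R z u x t = \<phi> t z"
proof -
  have "fst (pdmp_skeleton \<phi> W R z u x k) \<le> ennreal t \<longleftrightarrow> k = 0" for k
  proof
    assume k: "fst (pdmp_skeleton \<phi> W R z u x k) \<le> ennreal t"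
    have "W z (u 0) \<le> fst (pdmp_skeleton \<phi> W R z u x k)" if "k \<noteq> 0"
      using pdmp_jump_times_mono[of "Suc 0" k \<phi> W R z u x] that
      by (simp add: Let_def del: One_nat_def)
    with k assms show "k = 0" by fastforce
  qed simp
  then show ?thesis by (simp add: pdmp_state_def)
qed

text \<open>The hypothesis on the \<open>n\<close>-th jump makes the set of jumps up to \<open>t\<close> finite,
  so that the maximum in the definition of the state is a true maximum and shifts with the index.\<close>

lemma pdmp_state_after_first_jump:
  fixes \<phi> W R z u x
  defines "z' \<equiv> R (\<phi> (enn2real (W z (u 0))) z) (x 0)"
  assumes first: "W z (u 0) = ennreal r" "0 \<le> r" "r \<le> t"
    and later: "ennreal (t - r) < fst (pdmp_skeleton \<phi> W R z' (\<lambda>k. u (Suc k)) (\<lambda>k. x (Suc k)) n)"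
  shows "pdmp_state \<phi> W R z u x t = pdmp_state \<phi> W R z' (\<lambda>k. u (Suc k)) (\<lambda>k. x (Suc k)) (t - r)"
proof -
  define sk where "sk = pdmp_skeleton \<phi> W R z u x"
  define sk' where "sk' = pdmp_skeleton \<phi> W R z' (\<lambda>k. u (Suc k)) (\<lambda>k. x (Suc k))"
  define J where "J = {k. fst (sk' k) \<le> ennreal (t - r)}"
  have sk_Suc: "sk (Suc k) = (ennreal r + fst (sk' k), snd (sk' k))" for k
    unfolding sk_def sk'_def pdmp_skeleton_Suc_shift
    by (simp add: Let_def case_prod_unfold z'_def first)
  have J: "finite J" "0 \<in> J"
    unfolding J_def sk'_def using finite_jumps_before[OF later] by auto
  have "{k. fst (sk k) \<le> ennreal t} = insert 0 (Suc ` J)"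
  proof (intro set_eqI)
    fix k show "k \<in> {k. fst (sk k) \<le> ennreal t} \<longleftrightarrow> k \<in> insert 0 (Suc ` J)"
    proof (cases k)
      case 0
      then show ?thesis by (simp add: sk_def)
    next
      case (Suc j)
      then show ?thesis
        using ennreal_add_le_iff[OF first(2,3)] by (auto simp: sk_Suc J_def)
    qed
  qed
  moreover have "Max (insert 0 (Suc ` J)) = Suc (Max J)"
  proof -
    have "J \<noteq> {}" using J by auto
    with J show ?thesis by (subst Max_insert) (auto simp: mono_Max_commute[OF mono_Suc])
  qed
  ultimately have N: "Max {k. fst (sk k) \<le> ennreal t} = Suc (Max J)" by simp
  have "Max J \<in> J" using J by (intro Max_in) auto
  then have "fst (sk' (Max J)) \<le> ennreal (t - r)" by (simp add: J_def)
  then obtain q where q: "fst (sk' (Max J)) = ennreal q" "0 \<le> q"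
    by (cases "fst (sk' (Max J))") (auto simp: top_unique)
  have "pdmp_state \<phi> W R z u x t = \<phi> (t - enn2real (fst (sk (Suc (Max J))))) (snd (sk (Suc (Max J))))"
    unfolding pdmp_state_def sk_def[symmetric] N by (simp add: case_prod_unfold Let_def)
  also have "\<dots> = \<phi> (t - r - enn2real (fst (sk' (Max J)))) (snd (sk' (Max J)))"
    using q first(2) by (simp add: sk_Suc diff_diff_eq ennreal_plus[symmetric] del: ennreal_plus)
  also have "\<dots> = pdmp_state \<phi> W R z' (\<lambda>k. u (Suc k)) (\<lambda>k. x (Suc k)) (t - r)"
    unfolding pdmp_state_def sk'_def[symmetric] J_def[symmetric] by (simp add: case_prod_unfold Let_def)
  finally show ?thesis .
qed

text \<open>The value is \<open>f\<close> of the state at time \<open>t\<close> if fewer than \<open>n\<close> jumps happen up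
  to \<open>t\<close>, and \<open>c\<close> otherwise. Restarting at the first jump expresses this without
  a maximum over jump indices. With \<open>f = 0\<close> and \<open>c = 1\<close> it is the indicator of
  at least \<open>n\<close> jumps, so one recursion governs both the approximations and their errors.\<close>

primrec truncated ::
  "(real \<Rightarrow> 'a \<Rightarrow> 'a) \<Rightarrow> ('a \<Rightarrow> real \<Rightarrow> ennreal) \<Rightarrow> ('a \<Rightarrow> 's \<Rightarrow> 'a) \<Rightarrow> ('a \<Rightarrow> real) \<Rightarrow> real \<Rightarrow>
   nat \<Rightarrow> real \<Rightarrow> 'a \<Rightarrow> (nat \<Rightarrow> real \<times> 's) \<Rightarrow> real" where
  "truncated \<phi> W R f c 0 t z \<omega> = c"
| "truncated \<phi> W R f c (Suc n) t z \<omega> =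
     (let w = W z (fst (\<omega> 0))
      in if ennreal t < w then f (\<phi> t z)
         else truncated \<phi> W R f c n (t - enn2real w) (R (\<phi> (enn2real w) z) (snd (\<omega> 0))) (\<lambda>k. \<omega> (Suc k)))"

lemma truncated_eq_state:
  assumes "0 \<le> t"
  shows "truncated \<phi> W R f c n t z \<omega> =
    (if ennreal t < fst (pdmp_skeleton \<phi> W R z (\<lambda>k. fst (\<omega> k)) (\<lambda>k. snd (\<omega> k)) n)
     then f (pdmp_state \<phi> W R z (\<lambda>k. fst (\<omega> k)) (\<lambda>k. snd (\<omega> k)) t) else c)"
  using assms
proof (induction n arbitrary: t z \<omega>)
  case (Suc n)
  define w where "w = W z (fst (\<omega> 0))"
  define z' where "z' = R (\<phi> (enn2real w) z) (snd (\<omega> 0))"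
  let ?T = "fst (pdmp_skeleton \<phi> W R z (\<lambda>k. fst (\<omega> k)) (\<lambda>k. snd (\<omega> k)) (Suc n))"
  let ?T' = "fst (pdmp_skeleton \<phi> W R z' (\<lambda>k. fst (\<omega> (Suc k))) (\<lambda>k. snd (\<omega> (Suc k))) n)"
  have T: "?T = w + ?T'"
    by (subst pdmp_skeleton_Suc_shift) (simp add: Let_def case_prod_unfold w_def z'_def)
  show ?case
  proof (cases "ennreal t < w")
    case True
    then have "ennreal t < ?T" unfolding T by (rule less_le_trans) simp
    with True show ?thesis
      by (simp only: truncated.simps Let_def w_def[symmetric] if_True)
        (subst pdmp_state_before_first_jump, simp_all add: w_def)
  next
    case False
    then obtain r where r: "w = ennreal r" "0 \<le> r" "r \<le> t"
      using Suc.prems by (cases w) (auto simp: not_less top_unique)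
    have iff: "ennreal t < ?T \<longleftrightarrow> ennreal (t - r) < ?T'"
      unfolding T r not_le[symmetric] using ennreal_add_le_iff[OF r(2,3)] by simp
    have step: "truncated \<phi> W R f c (Suc n) t z \<omega>
        = truncated \<phi> W R f c n (t - r) z' (\<lambda>k. \<omega> (Suc k))"
      using False r by (simp add: Let_def w_def[symmetric] z'_def)
    show ?thesis
    proof (cases "ennreal (t - r) < ?T'")
      case True
      have "pdmp_state \<phi> W R z (\<lambda>k. fst (\<omega> k)) (\<lambda>k. snd (\<omega> k)) t
          = pdmp_state \<phi> W R z' (\<lambda>k. fst (\<omega> (Suc k))) (\<lambda>k. snd (\<omega> (Suc k))) (t - r)"
        using pdmp_state_after_first_jump[of W z "\<lambda>k. fst (\<omega> k)" r t \<phi> R "\<lambda>k. snd (\<omega> k)" n] r True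
        by (simp add: w_def[symmetric] z'_def)
      then show ?thesis
        unfolding step iff using Suc.IH[of "t - r" z' "\<lambda>k. \<omega> (Suc k)"] r True by simp
    next
      case False
      then show ?thesis
        unfolding step iff using Suc.IH[of "t - r" z' "\<lambda>k. \<omega> (Suc k)"] r by simp
    qed
  qed
qed simp

lemma abs_truncated_le:
  assumes "\<And>y. \<bar>f y\<bar> \<le> C" "\<bar>c\<bar> \<le> C"
  shows "\<bar>truncated \<phi> W R f c n t z \<omega>\<bar> \<le> C"
  by (induction n arbitrary: t z \<omega>) (auto simp: Let_def assms)

lemma pdmp_skeleton_forward:
  "pdmp_skeleton (\<lambda>t. \<phi> (max 0 t)) W R z u x k = pdmp_skeleton \<phi> W R z u x k"
  by (induction k) (simp_all add: max_absorb2)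

text \<open>Nothing is known about the flow at negative times, not even measurability. Clipping the time
  at \<open>0\<close> gives a jointly measurable map. The state does not change, because the selected
  jump time is at most \<open>t\<close> even when the index is a default value: then infinitely many
  jumps, hence all of them, happen up to \<open>t\<close>.\<close>

lemma pdmp_state_forward:
  assumes "0 \<le> t"
  shows "pdmp_state (\<lambda>t. \<phi> (max 0 t)) W R z u x t = pdmp_state \<phi> W R z u x t"
proof -
  define sk where "sk = pdmp_skeleton \<phi> W R z u x"
  define J where "J = {k. fst (sk k) \<le> ennreal t}"
  define N where "N = Max J"
  have "fst (sk N) \<le> ennreal t"
  proof (cases "finite J")
    case True
    moreover have "0 \<in> J" by (simp add: J_def sk_def)
    ultimately have "N \<in> J" unfolding N_def by (intro Max_in) auto
    then show ?thesis by (simp add: J_def)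
  next
    case False
    then show ?thesis
      using finite_jumps_before[of t \<phi> W R z u x N] unfolding J_def sk_def by (meson not_le)
  qed
  then have "enn2real (fst (sk N)) \<le> t"
    using assms by (cases "fst (sk N)") (auto simp: top_unique)
  then show ?thesis
    unfolding pdmp_state_def pdmp_skeleton_forward sk_def[symmetric] J_def[symmetric] N_def[symmetric]
    by (simp add: case_prod_unfold Let_def max_absorb2)
qed

lemma truncated_forward:
  "0 \<le> t \<Longrightarrow> truncated (\<lambda>t. \<phi> (max 0 t)) W R f c n t z \<omega> = truncated \<phi> W R f c n t z \<omega>"
  by (simp add: truncated_eq_state pdmp_skeleton_forward pdmp_state_forward)

text \<open>The end points of paths of total duration \<open>t\<close> that alternate flow and jumps, built
  from the first jump to match the recursion for \<^const>\<open>truncated\<close>.\<close>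

inductive pdmp_reachable for \<phi> :: "real \<Rightarrow> 'a \<Rightarrow> 'a" and R :: "'a \<Rightarrow> 's \<Rightarrow> 'a" and S :: "'s set" where
  flow: "0 \<le> t \<Longrightarrow> pdmp_reachable \<phi> R S t z (\<phi> t z)"
| jump: "\<lbrakk>0 \<le> s; \<xi> \<in> S; pdmp_reachable \<phi> R S t (R (\<phi> s z) \<xi>) y\<rbrakk> \<Longrightarrow> pdmp_reachable \<phi> R S (s + t) z y"

lemma truncated_reachable:
  assumes "0 \<le> t" "\<And>k. snd (\<omega> k) \<in> S"
  shows "truncated \<phi> W R f c n t z \<omega> = c \<or>
    (\<exists>y. pdmp_reachable \<phi> R S t z y \<and> truncated \<phi> W R f c n t z \<omega> = f y)"
  using assms
proof (induction n arbitrary: t z \<omega>)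
  case (Suc n)
  define w where "w = W z (fst (\<omega> 0))"
  show ?case
  proof (cases "ennreal t < w")
    case True
    with Suc.prems show ?thesis
      by (auto simp: Let_def w_def[symmetric] intro: pdmp_reachable.flow)
  next
    case False
    then obtain r where r: "w = ennreal r" "0 \<le> r" "r \<le> t"
      using Suc.prems by (cases w) (auto simp: not_less top_unique)
    define z' where "z' = R (\<phi> r z) (snd (\<omega> 0))"
    have "truncated \<phi> W R f c (Suc n) t z \<omega>
        = truncated \<phi> W R f c n (t - r) z' (\<lambda>k. \<omega> (Suc k))"
      using False r by (simp add: Let_def w_def[symmetric] z'_def)
    moreover have "pdmp_reachable \<phi> R S t z y" if "pdmp_reachable \<phi> R S (t - r) z' y" for y
      using pdmp_reachable.jump[of r "snd (\<omega> 0)" S \<phi> R "t - r" z y] that r Suc.prems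
      by (simp add: z'_def)
    ultimately show ?thesis
      using Suc.IH[of "t - r" "\<lambda>k. \<omega> (Suc k)" z'] r Suc.prems by auto
  qed
qed simp

lemma pdmp_reachable_path:
  assumes "pdmp_reachable \<phi> R S t z y"
  shows "\<exists>k \<tau> \<xi>. (\<forall>i\<le>k. 0 \<le> \<tau> i) \<and> (\<Sum>i\<le>k. \<tau> i) = t \<and> (\<forall>i\<in>{1..k}. \<xi> i \<in> S) \<and> y = pdmp_path \<phi> R \<tau> \<xi> k z"
  using assms
proof induction
  case (flow t z)
  then show ?case by (intro exI[of _ 0] exI[of _ "\<lambda>_. t"]) auto
next
  case (jump s \<xi> t z y)
  then obtain k \<tau> \<eta> where path: "\<forall>i\<le>k. 0 \<le> \<tau> i" "(\<Sum>i\<le>k. \<tau> i) = t"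
      "\<forall>i\<in>{1..k}. \<eta> i \<in> S" "y = pdmp_path \<phi> R \<tau> \<eta> k (R (\<phi> s z) \<xi>)"
    by blast
  define \<tau>' where "\<tau>' = case_nat s \<tau>"
  \<comment> \<open>The marks of a path are numbered from \<open>1\<close>; the value at \<open>0\<close> is arbitrary.\<close>
  define \<eta>' where "\<eta>' = (\<lambda>i. if i \<le> 1 then \<xi> else \<eta> (i - 1))"
  have "pdmp_path \<phi> R \<tau>' \<eta>' (Suc j) z = pdmp_path \<phi> R \<tau> \<eta> j (R (\<phi> s z) \<xi>)" for j
    by (induction j) (simp_all add: \<tau>'_def \<eta>'_def)
  moreover have "(\<Sum>i\<le>Suc k. \<tau>' i) = s + t"
    unfolding sum.atMost_Suc_shift by (simp add: \<tau>'_def path)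
  moreover have "\<forall>i\<le>Suc k. 0 \<le> \<tau>' i"
    using path jump.hyps by (auto simp: \<tau>'_def split: nat.split)
  moreover have "\<forall>i\<in>{1..Suc k}. \<eta>' i \<in> S"
  proof
    fix i assume "i \<in> {1..Suc k}"
    then show "\<eta>' i \<in> S"
      by (cases i) (use path(3) jump.hyps(2) in \<open>auto simp: \<eta>'_def\<close>)
  qed
  ultimately show ?case
    using path(4) by (intro exI[of _ "Suc k"] exI[of _ \<tau>'] exI[of _ \<eta>']) auto
qed

section \<open>First-jump recursion for truncated expectations\<close>

lemma (in prob_space) abs_expectation_le:
  fixes h :: "'a \<Rightarrow> real"
  assumes [measurable]: "h \<in> borel_measurable M" and bound: "\<And>x. x \<in> space M \<Longrightarrow> \<bar>h x\<bar> \<le> C"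
  shows "\<bar>expectation h\<bar> \<le> C"
proof -
  have int: "integrable M h"
    by (rule integrable_const_bound[where B = C]) (auto intro: bound)
  have "expectation h \<le> C"
    by (intro integral_le_const int AE_I2) (use bound in fastforce)
  moreover have "- C \<le> expectation h"
    by (intro integral_ge_const int AE_I2) (use bound in fastforce)
  ultimately show ?thesis by simp
qed

lemma prob_space_unif01: "prob_space unif01"
  by (rule prob_spaceI) (simp add: unif01_def space_restrict_space emeasure_restrict_space)

text \<open>The waiting-time function \<open>W\<close> is tied to the rate only through its law. The jump maps
  need to be almost surely continuous only where jumps can occur.\<close>

locale pdmp = lipschitz_flow g \<phi> L + Xi: prob_space Xi
  for g :: "'a::euclidean_space \<Rightarrow> 'a" and \<phi> :: "real \<Rightarrow> 'a \<Rightarrow> 'a" and L :: real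
    and Xi :: "'s measure" +
  fixes lam :: "'a \<Rightarrow> real"
    and R :: "'a \<Rightarrow> 's \<Rightarrow> 'a"
    and \<mu> :: "'a \<Rightarrow> ennreal measure"
    and W :: "'a \<Rightarrow> real \<Rightarrow> ennreal"
  assumes lam_cont: "continuous_on UNIV lam"
    and lam_nonneg: "\<And>z. 0 \<le> lam z"
    and R_meas: "(\<lambda>(z, \<xi>). R z \<xi>) \<in> borel \<Otimes>\<^sub>M Xi \<rightarrow>\<^sub>M borel"
    and R_cont: "\<And>z. 0 < lam z \<Longrightarrow> AE \<xi> in Xi. isCont (\<lambda>y. R y \<xi>) z"
    and waiting_law_\<mu>: "\<And>z. is_waiting_law \<phi> lam z (\<mu> z)"
    and W_meas: "(\<lambda>(z, u). W z u) \<in> borel \<Otimes>\<^sub>M unif01 \<rightarrow>\<^sub>M borel"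
    and W_law: "\<And>z. distr unif01 borel (W z) = \<mu> z"
begin

sublocale unif01: prob_space unif01 by (rule prob_space_unif01)

sublocale pair_prob_space unif01 Xi ..

sublocale marks: sequence_space "unif01 \<Otimes>\<^sub>M Xi" ..

abbreviation marks :: "(nat \<Rightarrow> real \<times> 's) measure" where
  "marks \<equiv> marks.S"

sublocale sequences: pair_prob_space "unif01 \<Otimes>\<^sub>M Xi" marks ..

abbreviation \<psi> :: "real \<Rightarrow> 'a \<Rightarrow> 'a" where
  "\<psi> \<equiv> \<lambda>t. \<phi> (max 0 t)"

lemma forward_flow_measurable [measurable (raw)]:
  assumes [measurable]: "a \<in> borel_measurable N" "h \<in> borel_measurable N"
  shows "(\<lambda>x. \<psi> (a x) (h x)) \<in> borel_measurable N"
proof -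
  have "continuous_on UNIV (\<lambda>p :: real \<times> 'a. (\<lambda>(t, z). \<phi> t z) (max 0 (fst p), snd p))"
    by (rule continuous_on_compose2[OF continuous_on_flow]) (auto intro!: continuous_intros)
  then have "(\<lambda>p :: real \<times> 'a. \<psi> (fst p) (snd p)) \<in> borel_measurable (borel \<Otimes>\<^sub>M borel)"
    unfolding borel_prod by (intro borel_measurable_continuous_onI) simp
  from measurable_compose[OF measurable_Pair[OF assms] this] show ?thesis by simp
qed

lemma R_measurable [measurable (raw)]:
  assumes "h \<in> borel_measurable N" "k \<in> N \<rightarrow>\<^sub>M Xi"
  shows "(\<lambda>x. R (h x) (k x)) \<in> borel_measurable N"
  using measurable_compose[OF measurable_Pair[OF assms] R_meas] by simp

lemma W_measurable [measurable (raw)]: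
  assumes "h \<in> borel_measurable N" "k \<in> N \<rightarrow>\<^sub>M unif01"
  shows "(\<lambda>x. W (h x) (k x)) \<in> borel_measurable N"
  using measurable_compose[OF measurable_Pair[OF assms] W_meas] by simp

lemma shift_measurable [measurable]: "(\<lambda>\<omega> k. \<omega> (Suc k)) \<in> marks \<rightarrow>\<^sub>M marks"
  by (rule measurable_PiM_single') (auto simp: space_PiM PiE_iff)

lemma truncated_measurable:
  assumes [measurable]: "f \<in> borel_measurable borel"
  shows "(\<lambda>p. truncated \<psi> W R f c n (fst p) (fst (snd p)) (snd (snd p)))
    \<in> borel_measurable (borel \<Otimes>\<^sub>M borel \<Otimes>\<^sub>M marks)"
proof (induction n)
  case (Suc n)
  let ?N = "borel \<Otimes>\<^sub>M borel \<Otimes>\<^sub>M marks"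
  let ?w = "\<lambda>p. W (fst (snd p)) (fst (snd (snd p) 0))"
  have [measurable]: "?w \<in> borel_measurable ?N" by measurable
  have "(\<lambda>p. (fst p - enn2real (?w p),
        R (\<psi> (enn2real (?w p)) (fst (snd p))) (snd (snd (snd p) 0)),
        \<lambda>k. snd (snd p) (Suc k))) \<in> ?N \<rightarrow>\<^sub>M ?N"
    by measurable
  from measurable_compose[OF this Suc] have [measurable]:
    "(\<lambda>p. truncated \<psi> W R f c n (fst p - enn2real (?w p))
        (R (\<psi> (enn2real (?w p)) (fst (snd p))) (snd (snd (snd p) 0)))
        (\<lambda>k. snd (snd p) (Suc k))) \<in> borel_measurable ?N"
    by simp
  have [measurable]: "(\<lambda>p. f (\<psi> (fst p) (fst (snd p)))) \<in> borel_measurable ?N" by measurable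
  show ?case unfolding truncated.simps Let_def by measurable
qed simp

text \<open>The expectation is taken on the space of mark sequences and for the flow with clipped time, so
  that it is jointly measurable in time and start point and can be integrated again.\<close>

definition truncated_expectation :: "('a \<Rightarrow> real) \<Rightarrow> real \<Rightarrow> nat \<Rightarrow> real \<Rightarrow> 'a \<Rightarrow> real" where
  "truncated_expectation f c n t z = (\<integral>\<omega>. truncated \<psi> W R f c n t z \<omega> \<partial>marks)"

lemma truncated_measurable' [measurable (raw)]:
  assumes "f \<in> borel_measurable borel" "a \<in> borel_measurable N" "h \<in> borel_measurable N"
    "k \<in> N \<rightarrow>\<^sub>M marks"
  shows "(\<lambda>x. truncated \<psi> W R f c n (a x) (h x) (k x)) \<in> borel_measurable N"
  using measurable_compose[OF measurable_Pair[OF assms(2) measurable_Pair[OF assms(3,4)]]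
      truncated_measurable[OF assms(1), of c n]] by simp

lemma truncated_expectation_measurable [measurable (raw)]:
  assumes [measurable]: "f \<in> borel_measurable borel" "a \<in> borel_measurable N" "h \<in> borel_measurable N"
  shows "(\<lambda>x. truncated_expectation f c n (a x) (h x)) \<in> borel_measurable N"
  unfolding truncated_expectation_def by measurable

definition hazard :: "'a \<Rightarrow> real \<Rightarrow> real" where
  "hazard z t = integral {0..t} (\<lambda>s. lam (\<phi> s z))"

definition jump_density :: "'a \<Rightarrow> real \<Rightarrow> real" where
  "jump_density z s = lam (\<phi> s z) * exp (- hazard z s)"

lemma waiting_law_at: "waiting_law (\<mu> z) (\<lambda>s. lam (\<phi> s z))"
proof
  show "continuous_on {0..} (\<lambda>s. lam (\<phi> s z))"
    by (rule continuous_on_compose2[OF lam_cont continuous_on_flow_time]) auto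
qed (use waiting_law_\<mu>[of z] lam_nonneg in \<open>auto simp: is_waiting_law_def\<close>)

lemma hazard_nonneg: "0 \<le> hazard z s"
  unfolding hazard_def by (rule Henstock_Kurzweil_Integration.integral_nonneg) (auto simp: lam_nonneg
    intro!: integrable_continuous_real waiting_law.rate_continuous_Icc[OF waiting_law_at])

lemma jump_density_nonneg: "0 \<le> jump_density z s"
  by (simp add: jump_density_def lam_nonneg)

lemma jump_density_le: "jump_density z s \<le> lam (\<phi> s z)"
  using hazard_nonneg[of z s] lam_nonneg[of "\<phi> s z"]
  by (simp add: jump_density_def mult_left_le)

context
  fixes f :: "'a \<Rightarrow> real" and c C :: real
  assumes f [measurable]: "f \<in> borel_measurable borel"
    and f_bound: "\<And>y. \<bar>f y\<bar> \<le> C" and c_bound: "\<bar>c\<bar> \<le> C"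
begin

lemma truncated_integrable: "integrable marks (truncated \<psi> W R f c n t z)"
  by (rule marks.P.integrable_const_bound[where B = C])
    (auto intro: abs_truncated_le f_bound c_bound)

lemma abs_truncated_expectation_le: "\<bar>truncated_expectation f c n t z\<bar> \<le> C"
  unfolding truncated_expectation_def
  by (intro marks.P.abs_expectation_le abs_truncated_le f_bound c_bound) auto

lemma truncated_expectation_first_mark:
  "truncated_expectation f c (Suc n) t z =
    (\<integral>u. (\<integral>\<xi>. (if ennreal t < W z u then f (\<psi> t z)
       else truncated_expectation f c n (t - enn2real (W z u)) (R (\<psi> (enn2real (W z u)) z) \<xi>)) \<partial>Xi) \<partial>unif01)"
proof -
  let ?h = "truncated \<psi> W R f c (Suc n) t z"
  let ?j = "\<lambda>p. if ennreal t < W z (fst p) then f (\<psi> t z)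
       else truncated_expectation f c n (t - enn2real (W z (fst p))) (R (\<psi> (enn2real (W z (fst p))) z) (snd p))"
  have "truncated_expectation f c (Suc n) t z
      = (\<integral>\<omega>. ?h \<omega> \<partial>distr ((unif01 \<Otimes>\<^sub>M Xi) \<Otimes>\<^sub>M marks) marks (\<lambda>(s, \<omega>). case_nat s \<omega>))"
    unfolding truncated_expectation_def marks.PiM_iter ..
  also have "\<dots> = (\<integral>p. ?h (case_nat (fst p) (snd p)) \<partial>((unif01 \<Otimes>\<^sub>M Xi) \<Otimes>\<^sub>M marks))"
    by (subst integral_distr) (auto simp: case_prod_unfold)
  also have "\<dots> = (\<integral>p. (\<integral>\<omega>. ?h (case_nat p \<omega>) \<partial>marks) \<partial>(unif01 \<Otimes>\<^sub>M Xi))"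
    by (subst sequences.integral_fst'[symmetric])
      (auto intro!: sequences.P.integrable_const_bound[where B = C]
        abs_truncated_le f_bound c_bound simp del: truncated.simps)
  also have "\<dots> = (\<integral>p. ?j p \<partial>(unif01 \<Otimes>\<^sub>M Xi))"
    by (intro Bochner_Integration.integral_cong refl)
      (simp add: Let_def truncated_expectation_def marks.P.prob_space)
  also have "\<dots> = (\<integral>u. (\<integral>\<xi>. ?j (u, \<xi>) \<partial>Xi) \<partial>unif01)"
    by (subst integral_fst'[symmetric])
      (auto intro!: P.integrable_const_bound[where B = C] abs_truncated_expectation_le f_bound)
  finally show ?thesis unfolding fst_conv snd_conv .
qed

text \<open>Conditioning on the first jump: either the process flows until \<open>t\<close>, or it jumps at
  some \<open>s\<close> and restarts with the remaining time. Continuity in the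
  start point, decay at infinity and the bound on the number of jumps are inductions along this formula.\<close>

lemma truncated_expectation_Suc:
  assumes t: "0 \<le> t"
  shows "truncated_expectation f c (Suc n) t z = f (\<phi> t z) * exp (- hazard z t)
    + (\<integral>s. indicator {0..t} s * jump_density z s *
         (\<integral>\<xi>. truncated_expectation f c n (t - s) (R (\<phi> s z) \<xi>) \<partial>Xi) \<partial>lborel)"
proof -
  interpret w: waiting_law "\<mu> z" "\<lambda>s. lam (\<phi> s z)" by (rule waiting_law_at)
  note [measurable_cong] = w.sets_\<mu>
  define k where "k = (\<lambda>s. \<integral>\<xi>. truncated_expectation f c n (t - s) (R (\<psi> s z) \<xi>) \<partial>Xi)"
  have [measurable]: "k \<in> borel_measurable borel" unfolding k_def by measurable
  have k_bound: "\<bar>k s\<bar> \<le> C" for s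
    unfolding k_def by (intro Xi.abs_expectation_le abs_truncated_expectation_le) auto
  have "truncated_expectation f c (Suc n) t z
      = (\<integral>u. (if ennreal t < W z u then f (\<psi> t z) else k (enn2real (W z u))) \<partial>unif01)"
    unfolding truncated_expectation_first_mark
    by (intro Bochner_Integration.integral_cong refl) (simp add: k_def Xi.prob_space)
  also have "\<dots> = (\<integral>w. (if ennreal t < w then f (\<psi> t z) else k (enn2real w)) \<partial>distr unif01 borel (W z))"
    by (subst integral_distr) auto
  also have "\<dots> = f (\<psi> t z) * exp (- hazard z t) + (\<integral>s. w.density_before t s * k s \<partial>lborel)"
    unfolding W_law hazard_def by (rule w.integral_waiting_law[OF t _ k_bound]) measurable
  also have "(\<integral>s. w.density_before t s * k s \<partial>lborel)
      = (\<integral>s. indicator {0..t} s * jump_density z s *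
         (\<integral>\<xi>. truncated_expectation f c n (t - s) (R (\<phi> s z) \<xi>) \<partial>Xi) \<partial>lborel)"
    by (intro Bochner_Integration.integral_cong refl)
      (auto simp: w.density_before_def jump_density_def hazard_def k_def max_absorb2 split: split_indicator)
  finally show ?thesis using t by (simp add: max_absorb2)
qed

end

end

section \<open>Limits of truncated expectations and the number of jumps\<close>

lemma tendsto_null_of_norm_le:
  fixes h :: "'i \<Rightarrow> 'b::real_normed_vector"
  assumes "(k \<longlongrightarrow> 0) F" "\<And>i. norm (h i) \<le> k i"
  shows "(h \<longlongrightarrow> 0) F"
  by (rule Lim_null_comparison[OF always_eventually assms(1)]) (use assms(2) in blast)

context pdmp
begin

lemma hazard_tendsto:
  assumes t: "0 \<le> t" and zs: "zs \<longlonglongrightarrow> z"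
  shows "(\<lambda>m. hazard (zs m) t) \<longlonglongrightarrow> hazard z t"
proof -
  have "continuous_on (UNIV \<times> cbox 0 t) (\<lambda>p. lam ((\<lambda>(t, z). \<phi> t z) (snd p, fst p)))"
    by (intro continuous_on_compose2[OF lam_cont] continuous_on_compose2[OF continuous_on_flow])
      (auto intro!: continuous_intros)
  then have "continuous_on UNIV (\<lambda>z. integral (cbox 0 t) (\<lambda>s. lam (\<phi> s z)))"
    by (intro integral_continuous_on_param) (simp add: case_prod_unfold)
  then show ?thesis
    unfolding hazard_def by (intro continuous_on_tendsto_compose[OF _ zs]) auto
qed

lemma flow_tendsto: "0 \<le> t \<Longrightarrow> zs \<longlonglongrightarrow> z \<Longrightarrow> (\<lambda>m. \<phi> t (zs m)) \<longlonglongrightarrow> \<phi> t z"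
  using continuous_on_tendsto_compose[OF continuous_on_flow_space] by simp

lemma jump_density_tendsto:
  "0 \<le> s \<Longrightarrow> zs \<longlonglongrightarrow> z \<Longrightarrow> (\<lambda>m. jump_density (zs m) s) \<longlonglongrightarrow> jump_density z s"
  unfolding jump_density_def
  by (intro tendsto_intros hazard_tendsto continuous_on_tendsto_compose[OF lam_cont] flow_tendsto) auto

lemma lam_bounded_on_orbits:
  fixes zs :: "nat \<Rightarrow> 'a"
  assumes "bounded (range zs)"
  obtains B where "\<And>s m. 0 \<le> s \<Longrightarrow> s \<le> t \<Longrightarrow> lam (\<phi> s (zs m)) \<le> B"
proof -
  obtain r where r: "\<And>m. norm (zs m) \<le> r"
    using assms by (auto simp: bounded_iff)
  have "compact ((\<lambda>p. lam ((\<lambda>(t, z). \<phi> t z) p)) ` ({0..t} \<times> cball 0 r))"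
    by (intro compact_continuous_image compact_Times compact_Icc compact_cball
        continuous_on_compose2[OF lam_cont] continuous_on_subset[OF continuous_on_flow]) auto
  then obtain B where B: "\<And>x. x \<in> (\<lambda>p. lam ((\<lambda>(t, z). \<phi> t z) p)) ` ({0..t} \<times> cball 0 r) \<Longrightarrow> norm x \<le> B"
    by (meson compact_imp_bounded bounded_iff)
  have "lam (\<phi> s (zs m)) \<le> B" if "0 \<le> s" "s \<le> t" for s m
  proof -
    have "norm (lam (\<phi> s (zs m))) \<le> B"
      by (rule B, rule image_eqI[where x = "(s, zs m)"]) (use that r in auto)
    then show ?thesis by simp
  qed
  then show thesis by (rule that)
qed

lemma abs_jump_term_le:
  assumes "lam (\<phi> s z) \<le> B" "\<bar>k\<bar> \<le> C"
  shows "\<bar>jump_density z s * k\<bar> \<le> B * C"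
  unfolding abs_mult using assms jump_density_nonneg[of z s] jump_density_le[of z s]
  by (intro mult_mono) auto

lemma jump_density_measurable [measurable]:
  "(\<lambda>s. indicator {0..t} s * jump_density z s) \<in> borel_measurable borel"
  using waiting_law.density_before_measurable[OF waiting_law_at[of z], of t]
  unfolding waiting_law.density_before_def[OF waiting_law_at[of z], abs_def] jump_density_def hazard_def .

lemma jump_integrand_measurable:
  assumes [measurable]: "f \<in> borel_measurable borel"
  shows "(\<lambda>s. indicator {0..t} s * jump_density z s *
     (\<integral>\<xi>. truncated_expectation f c n (t - s) (R (\<phi> s z) \<xi>) \<partial>Xi)) \<in> borel_measurable borel"
proof -
  have "(\<lambda>s. indicator {0..t} s * jump_density z s *
     (\<integral>\<xi>. truncated_expectation f c n (t - s) (R (\<psi> s z) \<xi>) \<partial>Xi)) \<in> borel_measurable borel"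
    by measurable
  then show ?thesis
    by (rule measurable_cong[THEN iffD1, rotated]) (auto simp: max_absorb2 split: split_indicator)
qed

text \<open>Dominated convergence in the jump time, with the dominating constant supplied by a bound on the
  rate along the orbits.\<close>

lemma jump_integral_tendsto:
  fixes zs :: "nat \<Rightarrow> 'a"
  assumes f [measurable]: "f \<in> borel_measurable borel" and f_bound: "\<And>y. \<bar>f y\<bar> \<le> C" and c_bound: "\<bar>c\<bar> \<le> C"
    and lam_bound: "\<And>s m. 0 \<le> s \<Longrightarrow> s \<le> t \<Longrightarrow> lam (\<phi> s (zs m)) \<le> B"
    and k [measurable]: "k \<in> borel_measurable borel"
    and lim: "\<And>s. 0 \<le> s \<Longrightarrow> s \<le> t \<Longrightarrow> (\<lambda>m. jump_density (zs m) s *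
      (\<integral>\<xi>. truncated_expectation f c n (t - s) (R (\<phi> s (zs m)) \<xi>) \<partial>Xi)) \<longlonglongrightarrow> k s"
  shows "(\<lambda>m. \<integral>s. indicator {0..t} s * jump_density (zs m) s *
      (\<integral>\<xi>. truncated_expectation f c n (t - s) (R (\<phi> s (zs m)) \<xi>) \<partial>Xi) \<partial>lborel)
    \<longlonglongrightarrow> (\<integral>s. indicator {0..t} s * k s \<partial>lborel)"
proof (rule integral_dominated_convergence[where w = "\<lambda>s. indicator {0..t} s * (B * C)"])
  let ?K = "\<lambda>s m. \<integral>\<xi>. truncated_expectation f c n (t - s) (R (\<phi> s (zs m)) \<xi>) \<partial>Xi"
  show "(\<lambda>s. indicator {0..t} s * jump_density (zs m) s * ?K s m) \<in> borel_measurable lborel" for m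
    using jump_integrand_measurable[OF f] by simp
  show "integrable lborel (\<lambda>s. indicator {0..t} s * (B * C))"
    by (intro integrable_mult_left integrable_real_indicator) (auto simp: emeasure_lborel_Icc_eq)
  show "AE s in lborel. norm (indicator {0..t} s * jump_density (zs m) s * ?K s m)
      \<le> indicator {0..t} s * (B * C)" for m
  proof (rule AE_I2)
    fix s :: real
    have "\<bar>?K s m\<bar> \<le> C"
      by (intro Xi.abs_expectation_le abs_truncated_expectation_le f f_bound c_bound) auto
    then show "norm (indicator {0..t} s * jump_density (zs m) s * ?K s m) \<le> indicator {0..t} s * (B * C)"
      using abs_jump_term_le[OF lam_bound[of s m]] by (auto split: split_indicator)
  qed
  show "AE s in lborel. (\<lambda>m. indicator {0..t} s * jump_density (zs m) s * ?K s m) \<longlonglongrightarrow> indicator {0..t} s * k s"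
    by (rule AE_I2) (use lim in \<open>auto split: split_indicator\<close>)
qed measurable

text \<open>For a fixed time the recursion only refers to the previous stage at fixed times, so continuity
  in the start point can be propagated on its own, one time at a time.\<close>

lemma truncated_expectation_tendsto:
  fixes zs :: "nat \<Rightarrow> 'a"
  assumes f_cont: "continuous_on UNIV f" and f_bound: "\<And>y. \<bar>f y\<bar> \<le> C" and c_bound: "\<bar>c\<bar> \<le> C"
    and "0 \<le> t" "zs \<longlonglongrightarrow> z"
  shows "(\<lambda>m. truncated_expectation f c n t (zs m)) \<longlonglongrightarrow> truncated_expectation f c n t z"
  using assms(4,5)
proof (induction n arbitrary: t zs z)
  case 0
  then show ?case by (simp add: truncated_expectation_def)
next
  case (Suc n)
  have f [measurable]: "f \<in> borel_measurable borel"
    by (rule borel_measurable_continuous_onI[OF f_cont])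
  note TE = abs_truncated_expectation_le[OF f f_bound c_bound]
  let ?K = "\<lambda>s z. \<integral>\<xi>. truncated_expectation f c n (t - s) (R (\<phi> s z) \<xi>) \<partial>Xi"
  obtain B where B: "\<And>s m. 0 \<le> s \<Longrightarrow> s \<le> t \<Longrightarrow> lam (\<phi> s (zs m)) \<le> B"
    using lam_bounded_on_orbits[of zs t] convergent_imp_bounded[OF Suc.prems(2)] by blast
  have lim: "(\<lambda>m. jump_density (zs m) s * ?K s (zs m)) \<longlonglongrightarrow> jump_density z s * ?K s z"
    if s: "0 \<le> s" "s \<le> t" for s
  proof (cases "0 < lam (\<phi> s z)")
    case True
    have "(\<lambda>m. ?K s (zs m)) \<longlonglongrightarrow> ?K s z"
    proof (rule integral_dominated_convergence[where w = "\<lambda>_. C"])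
      show "AE \<xi> in Xi. (\<lambda>m. truncated_expectation f c n (t - s) (R (\<phi> s (zs m)) \<xi>))
          \<longlonglongrightarrow> truncated_expectation f c n (t - s) (R (\<phi> s z) \<xi>)"
        using R_cont[OF True]
      proof eventually_elim
        case (elim \<xi>)
        then have "(\<lambda>m. R (\<phi> s (zs m)) \<xi>) \<longlonglongrightarrow> R (\<phi> s z) \<xi>"
          by (rule isCont_tendsto_compose) (rule flow_tendsto[OF s(1) Suc.prems(2)])
        then show ?case using s by (intro Suc.IH) auto
      qed
    qed (auto simp: TE)
    then show ?thesis by (intro tendsto_mult jump_density_tendsto s Suc.prems)
  next
    \<comment> \<open>No continuity of the jump map is available here, but the density tends to \<open>0\<close> and the
      integrand is bounded.\<close>
    case False
    then have 0: "jump_density z s = 0"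
      using lam_nonneg[of "\<phi> s z"] by (simp add: jump_density_def)
    have "(\<lambda>m. jump_density (zs m) s * C) \<longlonglongrightarrow> 0"
      using tendsto_mult[OF jump_density_tendsto[OF s(1) Suc.prems(2)] tendsto_const[of C]]
      by (simp add: 0)
    moreover have "norm (jump_density (zs m) s * ?K s (zs m)) \<le> jump_density (zs m) s * C" for m
    proof -
      have "\<bar>?K s (zs m)\<bar> \<le> C" by (intro Xi.abs_expectation_le TE) auto
      then show ?thesis
        by (simp add: abs_mult jump_density_nonneg mult_left_mono)
    qed
    ultimately have "(\<lambda>m. jump_density (zs m) s * ?K s (zs m)) \<longlonglongrightarrow> 0"
      by (rule tendsto_null_of_norm_le)
    then show ?thesis by (simp add: 0)
  qed
  have "(\<lambda>m. \<integral>s. indicator {0..t} s * jump_density (zs m) s * ?K s (zs m) \<partial>lborel)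
    \<longlonglongrightarrow> (\<integral>s. indicator {0..t} s * (indicator {0..t} s * jump_density z s * ?K s z) \<partial>lborel)"
  proof (rule jump_integral_tendsto[OF f f_bound c_bound B])
    show "(\<lambda>s. indicator {0..t} s * jump_density z s * ?K s z) \<in> borel_measurable borel"
      by (rule jump_integrand_measurable[OF f])
  qed (use lim in auto)
  also have "(\<lambda>s. indicator {0..t} s * (indicator {0..t} s * jump_density z s * ?K s z))
      = (\<lambda>s. indicator {0..t} s * jump_density z s * ?K s z)"
    by (auto split: split_indicator)
  finally have "(\<lambda>m. \<integral>s. indicator {0..t} s * jump_density (zs m) s * ?K s (zs m) \<partial>lborel)
    \<longlonglongrightarrow> (\<integral>s. indicator {0..t} s * jump_density z s * ?K s z \<partial>lborel)" .
  moreover have "(\<lambda>m. f (\<phi> t (zs m)) * exp (- hazard (zs m) t)) \<longlonglongrightarrow> f (\<phi> t z) * exp (- hazard z t)"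
    by (intro tendsto_intros hazard_tendsto continuous_on_tendsto_compose[OF f_cont] flow_tendsto Suc.prems) auto
  ultimately show ?case
    unfolding truncated_expectation_Suc[OF f f_bound c_bound Suc.prems(1)]
    by (intro tendsto_add)
qed

text \<open>If flow and jump maps push every start point sequence that tends to infinity to infinity again,
  then the recursion preserves decay at infinity. Dominated convergence needs a global bound on the
  rate here.\<close>

lemma truncated_expectation_vanishes:
  fixes zs :: "nat \<Rightarrow> 'a"
  assumes f_cont: "continuous_on UNIV f" and f_bound: "\<And>y. \<bar>f y\<bar> \<le> C"
    and f_vanishes: "(f \<longlongrightarrow> 0) at_infinity"
    and lam_bound: "\<And>y. lam y \<le> B"
    and flow_escapes: "\<And>s. 0 \<le> s \<Longrightarrow> filterlim (\<phi> s) at_infinity at_infinity"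
    and R_escapes: "\<And>\<xi>. \<xi> \<in> space Xi \<Longrightarrow> filterlim (\<lambda>y. R y \<xi>) at_infinity at_infinity"
    and "0 \<le> t" "filterlim zs at_infinity sequentially"
  shows "(\<lambda>m. truncated_expectation f 0 n t (zs m)) \<longlonglongrightarrow> 0"
  using assms(7,8)
proof (induction n arbitrary: t zs)
  case 0
  then show ?case by (simp add: truncated_expectation_def)
next
  case (Suc n)
  have f [measurable]: "f \<in> borel_measurable borel"
    by (rule borel_measurable_continuous_onI[OF f_cont])
  have "0 \<le> C" using f_bound[of undefined] by linarith
  then have c_bound: "\<bar>0\<bar> \<le> C" by simp
  note TE = abs_truncated_expectation_le[OF f f_bound c_bound]
  let ?K = "\<lambda>s z. \<integral>\<xi>. truncated_expectation f 0 n (t - s) (R (\<phi> s z) \<xi>) \<partial>Xi"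
  have lim: "(\<lambda>m. jump_density (zs m) s * ?K s (zs m)) \<longlonglongrightarrow> 0" if s: "0 \<le> s" "s \<le> t" for s
  proof -
    have "(\<lambda>m. ?K s (zs m)) \<longlonglongrightarrow> (\<integral>\<xi>. 0 \<partial>Xi)"
    proof (rule integral_dominated_convergence[where w = "\<lambda>_. C"])
      show "AE \<xi> in Xi. (\<lambda>m. truncated_expectation f 0 n (t - s) (R (\<phi> s (zs m)) \<xi>)) \<longlonglongrightarrow> 0"
      proof (rule AE_I2)
        fix \<xi> assume "\<xi> \<in> space Xi"
        then have "filterlim (\<lambda>m. R (\<phi> s (zs m)) \<xi>) at_infinity sequentially"
          by (intro filterlim_compose[OF R_escapes] filterlim_compose[OF flow_escapes[OF s(1)]] Suc.prems)
        then show "(\<lambda>m. truncated_expectation f 0 n (t - s) (R (\<phi> s (zs m)) \<xi>)) \<longlonglongrightarrow> 0"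
          using s by (intro Suc.IH) auto
      qed
    qed (auto simp: TE)
    then have "(\<lambda>m. B * \<bar>?K s (zs m)\<bar>) \<longlonglongrightarrow> 0"
      by (intro tendsto_mult_right_zero tendsto_rabs_zero) simp
    moreover have "norm (jump_density (zs m) s * ?K s (zs m)) \<le> B * \<bar>?K s (zs m)\<bar>" for m
      using abs_jump_term_le[OF lam_bound order_refl] by simp
    ultimately show ?thesis
      by (rule tendsto_null_of_norm_le)
  qed
  have "(\<lambda>m. \<integral>s. indicator {0..t} s * jump_density (zs m) s * ?K s (zs m) \<partial>lborel)
    \<longlonglongrightarrow> (\<integral>s. indicator {0..t} s * 0 \<partial>lborel)"
    by (rule jump_integral_tendsto[OF f f_bound c_bound lam_bound]) (use lim in auto)
  moreover have "(\<lambda>m. f (\<phi> t (zs m)) * exp (- hazard (zs m) t)) \<longlonglongrightarrow> 0"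
  proof (rule Lim_null_comparison[OF always_eventually])
    show "(\<lambda>m. \<bar>f (\<phi> t (zs m))\<bar>) \<longlonglongrightarrow> 0"
      using filterlim_compose[OF f_vanishes filterlim_compose[OF flow_escapes[OF Suc.prems(1)] Suc.prems(2)]]
      by (rule tendsto_rabs_zero)
    show "\<forall>m. norm (f (\<phi> t (zs m)) * exp (- hazard (zs m) t)) \<le> \<bar>f (\<phi> t (zs m))\<bar>"
      by (simp add: abs_mult mult_left_le hazard_nonneg)
  qed
  ultimately show ?case
    unfolding truncated_expectation_Suc[OF f f_bound c_bound Suc.prems(1)]
    using tendsto_add by fastforce
qed

text \<open>A set of pairs of remaining time and position that the process cannot leave before the remaining
  time is used up, and on which the rate is at most \<open>B\<close>. In the case of a bounded rate
  this is everything; in the norm-preserving case it is a sublevel set of the energy weighted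
  by the exponential of the remaining time.\<close>

definition rate_domain :: "real \<Rightarrow> (real \<Rightarrow> 'a \<Rightarrow> bool) \<Rightarrow> bool" where
  "rate_domain B D \<longleftrightarrow> (\<forall>t z. D t z \<longrightarrow>
     (\<forall>s\<in>{0..t}. lam (\<phi> s z) \<le> B \<and> (\<forall>\<xi>\<in>space Xi. D (t - s) (R (\<phi> s z) \<xi>))))"

text \<open>The probability of at least \<open>n\<close> jumps up to time \<open>t\<close> is dominated by the recursion
  of the simplex volumes, because the jump density is at most \<open>B\<close> on the domain. The
  bound tends to \<open>0\<close> uniformly for bounded times, which excludes explosion.\<close>

lemma many_jumps_le:
  assumes "rate_domain B D" "D t z" "0 \<le> t"
  shows "truncated_expectation (\<lambda>_. 0) 1 n t z \<le> (B * t) ^ n / fact n"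
  using assms(2,3)
proof (induction n arbitrary: t z)
  case 0
  then show ?case by (simp add: truncated_expectation_def marks.P.prob_space)
next
  case (Suc n)
  let ?TE = "truncated_expectation (\<lambda>_. 0) 1 n"
  have domain: "lam (\<phi> s z) \<le> B" "\<And>\<xi>. \<xi> \<in> space Xi \<Longrightarrow> D (t - s) (R (\<phi> s z) \<xi>)"
    if "0 \<le> s" "s \<le> t" for s
    using assms(1) Suc.prems(1) that unfolding rate_domain_def by auto
  have "0 \<le> B" using domain(1)[of 0] Suc.prems lam_nonneg[of "\<phi> 0 z"] by linarith
  have TE_nonneg: "0 \<le> ?TE r y" for r y
  proof -
    have "0 \<le> truncated \<psi> W R (\<lambda>_. 0) 1 n r y \<omega>" for \<omega>
      by (induction n arbitrary: r y \<omega>) (auto simp: Let_def)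
    then show ?thesis unfolding truncated_expectation_def by (intro Bochner_Integration.integral_nonneg)
  qed
  have TE_bound: "\<bar>?TE r y\<bar> \<le> 1" for r y
    by (rule abs_truncated_expectation_le) auto
  define d where "d = (\<lambda>s. B * ((B * (t - s)) ^ n / fact n))"
  \<comment> \<open>\<open>F\<close> is an antiderivative of the bound \<open>d\<close> for the integrand that the induction hypothesis
    gives.\<close>
  define F where "F = (\<lambda>s. - ((B * (t - s)) ^ Suc n / fact (Suc n)))"
  have d_measurable: "d \<in> borel_measurable borel" unfolding d_def by measurable
  have F_der: "(F has_real_derivative d s) (at s)" for s
  proof -
    have "((\<lambda>s. (B * (t - s)) ^ Suc n) has_real_derivative
        (1 + real n) * (- B * (B * (t - s)) ^ n)) (at s)"
      by (rule DERIV_power_Suc) (auto intro!: derivative_eq_intros)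
    from DERIV_minus[OF DERIV_cdivide[OF this, of "fact (Suc n)"]] show ?thesis
      unfolding F_def d_def by (simp add: divide_simps del: power_Suc)
  qed
  have d_nonneg: "0 \<le> d s" if "s \<in> {0..t}" for s
    unfolding d_def using that \<open>0 \<le> B\<close> by simp
  note FTC = d_measurable F_der d_nonneg Suc.prems(2)
  have "truncated_expectation (\<lambda>_. 0) 1 (Suc n) t z
      = (\<integral>s. indicator {0..t} s * jump_density z s * (\<integral>\<xi>. ?TE (t - s) (R (\<phi> s z) \<xi>) \<partial>Xi) \<partial>lborel)"
    by (subst truncated_expectation_Suc[where C = 1]) (use Suc.prems in auto)
  also have "\<dots> \<le> (\<integral>s. d s * indicator {0..t} s \<partial>lborel)"
  proof (rule integral_mono')
    show "integrable lborel (\<lambda>s. d s * indicator {0..t} s)"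
      by (rule integrable_FTC_Icc_nonneg[OF FTC])
    fix s :: real
    show "0 \<le> d s * indicator {0..t} s" using d_nonneg by (auto split: split_indicator)
    show "indicator {0..t} s * jump_density z s * (\<integral>\<xi>. ?TE (t - s) (R (\<phi> s z) \<xi>) \<partial>Xi)
        \<le> d s * indicator {0..t} s"
    proof (cases "s \<in> {0..t}")
      case True
      have "(\<integral>\<xi>. ?TE (t - s) (R (\<phi> s z) \<xi>) \<partial>Xi) \<le> (B * (t - s)) ^ n / fact n"
      proof (rule Xi.integral_le_const)
        show "integrable Xi (\<lambda>\<xi>. ?TE (t - s) (R (\<phi> s z) \<xi>))"
          by (rule Xi.integrable_const_bound[where B = 1]) (auto simp: TE_bound)
        show "AE \<xi> in Xi. ?TE (t - s) (R (\<phi> s z) \<xi>) \<le> (B * (t - s)) ^ n / fact n"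
          by (rule AE_I2, rule Suc.IH) (use domain(2) True in auto)
      qed
      moreover have "0 \<le> (\<integral>\<xi>. ?TE (t - s) (R (\<phi> s z) \<xi>) \<partial>Xi)"
        by (intro Bochner_Integration.integral_nonneg TE_nonneg)
      ultimately have "jump_density z s * (\<integral>\<xi>. ?TE (t - s) (R (\<phi> s z) \<xi>) \<partial>Xi) \<le> d s"
        unfolding d_def using True domain(1)[of s] jump_density_le[of z s] \<open>0 \<le> B\<close>
        by (intro mult_mono) auto
      with True show ?thesis by simp
    qed simp
  qed
  also have "\<dots> = F t - F 0" by (rule integral_FTC_Icc_nonneg[OF FTC])
  also have "\<dots> = (B * t) ^ Suc n / fact (Suc n)" by (simp add: F_def)
  finally show ?case .
qed

end

section \<open>The semigroup as a locally uniform limit\<close>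

text \<open>Dominated convergence is a statement on sequences, and the filter of neighbourhoods of infinity
  is countably generated.\<close>

lemma tendsto_at_infinity_sequentiallyI:
  fixes F :: "'a::real_normed_vector \<Rightarrow> 'b::topological_space"
  assumes "\<And>zs :: nat \<Rightarrow> 'a. filterlim zs at_infinity sequentially \<Longrightarrow> (\<lambda>m. F (zs m)) \<longlonglongrightarrow> l"
  shows "(F \<longlongrightarrow> l) at_infinity"
proof (rule topological_tendstoI, rule ccontr)
  fix S assume S: "open S" "l \<in> S" "\<not> eventually (\<lambda>z. F z \<in> S) at_infinity"
  then have "\<forall>n. \<exists>z. real n \<le> norm z \<and> F z \<notin> S"
    unfolding eventually_at_infinity by blast
  then obtain zs where zs: "\<And>n. real n \<le> norm (zs n)" "\<And>n. F (zs n) \<notin> S"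
    by metis
  have "filterlim (\<lambda>n. norm (zs n)) at_top sequentially"
    by (rule filterlim_at_top_mono[OF filterlim_real_sequentially]) (auto simp: zs)
  then have "(\<lambda>m. F (zs m)) \<longlonglongrightarrow> l"
    by (intro assms) (simp add: filterlim_at_infinity_conv_norm_at_top)
  then have "eventually (\<lambda>m. F (zs m) \<in> S) sequentially"
    using S by (intro topological_tendstoD)
  then show False using zs(2) by simp
qed

lemma C0_bounded:
  fixes f :: "'a::euclidean_space \<Rightarrow> real"
  assumes "f \<in> C0"
  obtains C where "\<And>y. \<bar>f y\<bar> \<le> C"
proof -
  have cont: "continuous_on UNIV f" and "(f \<longlongrightarrow> 0) at_infinity"
    using assms by (auto simp: C0_def)
  then have "eventually (\<lambda>y. \<bar>f y\<bar> < 1) at_infinity"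
    using tendstoD[of f 0 at_infinity 1] by (simp add: dist_norm)
  then obtain r where r: "\<And>y. r \<le> norm y \<Longrightarrow> \<bar>f y\<bar> < 1"
    by (auto simp: eventually_at_infinity)
  have "compact (f ` cball 0 r)"
    by (intro compact_continuous_image continuous_on_subset[OF cont]) auto
  from compact_imp_bounded[OF this] obtain b where "\<forall>x\<in>f ` cball 0 r. norm x \<le> b"
    unfolding bounded_iff by blast
  then have b: "\<bar>f y\<bar> \<le> b" if "y \<in> cball 0 r" for y
    using that by simp
  have "\<bar>f y\<bar> \<le> max 1 b" for y
    using r[of y] b[of y] by (cases "r \<le> norm y") auto
  then show thesis by (rule that)
qed

lemma C0_small_outside_ball:
  assumes "f \<in> C0" "0 < \<epsilon>"
  obtains r where "\<And>y. r \<le> norm y \<Longrightarrow> \<bar>f y\<bar> < \<epsilon>"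
  using assms tendstoD[of f 0 at_infinity \<epsilon>] that
  by (auto simp: C0_def dist_norm eventually_at_infinity)

context pdmp
begin

definition canonical_state :: "real \<Rightarrow> 'a \<Rightarrow> (nat \<Rightarrow> real \<times> 's) \<Rightarrow> 'a" where
  "canonical_state t z \<omega> = pdmp_state \<phi> W R z (\<lambda>k. fst (\<omega> k)) (\<lambda>k. snd (\<omega> k)) t"

definition transition :: "('a \<Rightarrow> real) \<Rightarrow> real \<Rightarrow> 'a \<Rightarrow> real" where
  "transition f t z = (\<integral>\<omega>. f (canonical_state t z \<omega>) \<partial>marks)"

text \<open>Measurability has to hold at every mark sequence, including those with infinitely many jumps,
  since the integral of a non-measurable function is \<open>0\<close> by convention. The maximum over an infinite
  set of indices is one fixed index, so the selected index is measurable throughout.\<close>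

lemma canonical_state_measurable:
  assumes t: "0 \<le> t"
  shows "canonical_state t z \<in> borel_measurable marks"
proof -
  let ?sk = "\<lambda>\<omega>. pdmp_skeleton \<psi> W R z (\<lambda>k. fst (\<omega> k)) (\<lambda>k. snd (\<omega> k))"
  have sk [measurable]: "(\<lambda>\<omega>. ?sk \<omega> k) \<in> marks \<rightarrow>\<^sub>M borel \<Otimes>\<^sub>M borel" for k
  proof (induction k)
    case (Suc k)
    note [measurable] = Suc
    have [measurable]: "(\<lambda>\<omega>. fst (?sk \<omega> k)) \<in> borel_measurable marks"
      "(\<lambda>\<omega>. snd (?sk \<omega> k)) \<in> borel_measurable marks"
      by measurable
    show ?case by (simp only: pdmp_skeleton.simps case_prod_unfold Let_def) measurable
  qed simp
  have [measurable]: "(\<lambda>\<omega>. fst (?sk \<omega> k)) \<in> borel_measurable marks"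
    "(\<lambda>\<omega>. snd (?sk \<omega> k)) \<in> borel_measurable marks" for k
    by measurable
  have N: "(\<lambda>\<omega>. Max {k. fst (?sk \<omega> k) \<le> ennreal t}) \<in> measurable marks (count_space UNIV)"
    by measurable
  have "(\<lambda>\<omega>. \<psi> (t - enn2real (fst (?sk \<omega> k))) (snd (?sk \<omega> k))) \<in> borel_measurable marks" for k
    by measurable
  then have "(\<lambda>\<omega>. pdmp_state \<psi> W R z (\<lambda>k. fst (\<omega> k)) (\<lambda>k. snd (\<omega> k)) t) \<in> borel_measurable marks"
    unfolding pdmp_state_def case_prod_unfold Let_def
    by (rule measurable_compose_countable[OF _ N])
  then show ?thesis
    unfolding canonical_state_def[abs_def] using t by (simp add: pdmp_state_forward)
qed

lemma transition_truncation_error: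
  assumes f [measurable]: "f \<in> borel_measurable borel"
    and f_bound: "\<And>y. \<bar>f y\<bar> \<le> C" and c_bound: "\<bar>c\<bar> \<le> C" and t: "0 \<le> t"
  shows "\<bar>transition f t z - truncated_expectation f c n t z\<bar>
    \<le> 2 * C * truncated_expectation (\<lambda>_. 0) 1 n t z"
proof -
  note [measurable] = canonical_state_measurable[OF t]
  let ?h = "\<lambda>f c. truncated \<psi> W R f c n t z"
  have int: "integrable marks (\<lambda>\<omega>. f (canonical_state t z \<omega>))"
    by (rule marks.P.integrable_const_bound[where B = C]) (auto simp: f_bound)
  have int_h: "integrable marks (?h f c)" "integrable marks (?h (\<lambda>_. 0) 1)"
    using truncated_integrable[OF f f_bound c_bound] truncated_integrable[of "\<lambda>_. 0" 1 1] by auto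
  have "\<bar>f (canonical_state t z \<omega>) - ?h f c \<omega>\<bar> \<le> 2 * C * ?h (\<lambda>_. 0) 1 \<omega>" for \<omega>
    using f_bound[of "canonical_state t z \<omega>"] c_bound t
    by (auto simp: truncated_eq_state pdmp_skeleton_forward pdmp_state_forward canonical_state_def)
  then have le: "(\<integral>\<omega>. \<bar>f (canonical_state t z \<omega>) - ?h f c \<omega>\<bar> \<partial>marks) \<le> (\<integral>\<omega>. 2 * C * ?h (\<lambda>_. 0) 1 \<omega> \<partial>marks)"
    by (intro integral_mono integrable_abs Bochner_Integration.integrable_diff integrable_mult_right int int_h)
  have "\<bar>transition f t z - truncated_expectation f c n t z\<bar>
      = \<bar>\<integral>\<omega>. f (canonical_state t z \<omega>) - ?h f c \<omega> \<partial>marks\<bar>"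
    unfolding transition_def truncated_expectation_def
    by (simp add: Bochner_Integration.integral_diff[OF int int_h(1)])
  also have "\<dots> \<le> (\<integral>\<omega>. \<bar>f (canonical_state t z \<omega>) - ?h f c \<omega>\<bar> \<partial>marks)"
    by (rule integral_abs_bound)
  also note le
  finally show ?thesis unfolding truncated_expectation_def by simp
qed

lemma transition_truncation_error_on_domain:
  assumes "f \<in> borel_measurable borel" "\<And>y. \<bar>f y\<bar> \<le> C" "\<bar>c\<bar> \<le> C" "0 \<le> t"
    and D: "rate_domain B D" "D t z"
  shows "\<bar>transition f t z - truncated_expectation f c n t z\<bar> \<le> 2 * C * ((B * t) ^ n / fact n)"
proof -
  have "0 \<le> C" using assms(2)[of undefined] by linarith
  then have "2 * C * truncated_expectation (\<lambda>_. 0) 1 n t z \<le> 2 * C * ((B * t) ^ n / fact n)"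
    by (intro mult_left_mono many_jumps_le[OF D assms(4)]) auto
  with transition_truncation_error[OF assms(1-4)] show ?thesis by (rule order_trans)
qed

lemma truncation_error_tendsto: "(\<lambda>n. 2 * C * (x ^ n / fact n)) \<longlonglongrightarrow> (0 :: real)"
  using tendsto_mult_right_zero[OF summable_LIMSEQ_zero[OF summable_exp[of x]], of "2 * C"]
  by (simp add: divide_inverse mult.commute)

text \<open>With the constant \<open>c\<close> chosen as the value at the end of the undisturbed orbit, the
  truncation after one jump is deterministic, and the truncation error is at most \<open>2 C\<close> times the
  probability of a jump.\<close>

lemma transition_near_flow:
  assumes "f \<in> borel_measurable borel" "\<And>y. \<bar>f y\<bar> \<le> C" "0 \<le> t" "rate_domain B D" "D t z"
  shows "\<bar>transition f t z - f (\<phi> t z)\<bar> \<le> 2 * C * B * t"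
proof -
  have "truncated \<psi> W R f (f (\<phi> t z)) 1 t z \<omega> = f (\<phi> t z)" for \<omega>
    using assms(3) by (cases "ennreal t < W z (fst (\<omega> 0))") (simp_all add: Let_def max_absorb2)
  then have "truncated_expectation f (f (\<phi> t z)) 1 t z = f (\<phi> t z)"
    by (simp add: truncated_expectation_def marks.P.prob_space)
  with transition_truncation_error_on_domain[OF assms(1,2) assms(2)[of "\<phi> t z"] assms(3-5), of 1]
  show ?thesis by simp
qed

text \<open>The common consequence of the two growth conditions on which all local arguments rest: the
  process started in a ball meets only bounded rates during a bounded time.\<close>

definition locally_bounded_rates :: bool where
  "locally_bounded_rates \<longleftrightarrow> (\<forall>r t. \<exists>B D. 0 \<le> B \<and> rate_domain B D \<and>
     (\<forall>s z. 0 \<le> s \<longrightarrow> s \<le> t \<longrightarrow> norm z \<le> r \<longrightarrow> D s z))"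

text \<open>On balls the truncated expectations are continuous and converge uniformly.\<close>

lemma transition_continuous:
  assumes rates: locally_bounded_rates
    and f_cont: "continuous_on UNIV f" and f_bound: "\<And>y. \<bar>f y\<bar> \<le> C" and t: "0 \<le> t"
  shows "continuous_on UNIV (transition f t)"
  unfolding continuous_on_eq_continuous_at[OF open_UNIV]
proof
  fix z :: 'a
  have f: "f \<in> borel_measurable borel" by (rule borel_measurable_continuous_onI[OF f_cont])
  have "0 \<le> C" using f_bound[of undefined] by linarith
  then have c: "\<bar>0\<bar> \<le> C" by simp
  obtain B D where D: "rate_domain B D" "\<And>y. norm y \<le> norm z + 1 \<Longrightarrow> D t y"
    using rates t unfolding locally_bounded_rates_def by blast
  have "continuous_on (cball 0 (norm z + 1)) (transition f t)"
  proof (rule uniform_limit_theorem[where F = sequentially])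
    show "\<forall>\<^sub>F n in sequentially. continuous_on (cball 0 (norm z + 1)) (truncated_expectation f 0 n t)"
      by (intro always_eventually allI continuous_on_sequentiallyI
          truncated_expectation_tendsto[OF f_cont f_bound c t])
    show "uniform_limit (cball 0 (norm z + 1)) (\<lambda>n. truncated_expectation f 0 n t) (transition f t) sequentially"
    proof (rule uniform_limitI)
      fix e :: real assume "0 < e"
      from order_tendstoD(2)[OF truncation_error_tendsto this, of C "B * t"]
      show "\<forall>\<^sub>F n in sequentially. \<forall>y\<in>cball 0 (norm z + 1).
          dist (truncated_expectation f 0 n t y) (transition f t y) < e"
      proof eventually_elim
        case (elim n)
        show ?case
        proof
          fix y :: 'a assume "y \<in> cball 0 (norm z + 1)"
          then have "\<bar>transition f t y - truncated_expectation f 0 n t y\<bar> \<le> 2 * C * ((B * t) ^ n / fact n)"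
            by (intro transition_truncation_error_on_domain[OF f f_bound c t D(1)] D(2)) simp
          with elim show "dist (truncated_expectation f 0 n t y) (transition f t y) < e"
            by (simp add: dist_real_def abs_minus_commute)
        qed
      qed
    qed
  qed auto
  then show "isCont (transition f t) z"
    by (rule continuous_on_interior) (auto simp: interior_cball)
qed

text \<open>Far out both terms are small. In a ball a jump in a short time is unlikely, and without jumps
  uniform continuity of \<open>f\<close> along the flow on a compact set takes over.\<close>

lemma strongly_continuous:
  assumes rates: locally_bounded_rates and f: "f \<in> C0"
    and far: "\<And>\<epsilon>. 0 < \<epsilon> \<Longrightarrow> \<exists>\<rho> t0. 0 < t0 \<and>
      (\<forall>z t. \<rho> \<le> norm z \<longrightarrow> 0 \<le> t \<longrightarrow> t \<le> t0 \<longrightarrow> \<bar>transition f t z\<bar> \<le> \<epsilon>)"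
  shows "((\<lambda>t. SUP z. \<bar>transition f t z - f z\<bar>) \<longlongrightarrow> 0) (at_right 0)"
proof (rule tendstoI)
  fix \<epsilon> :: real assume \<epsilon>: "0 < \<epsilon>"
  have f_cont: "continuous_on UNIV f" using f by (simp add: C0_def)
  have f_meas: "f \<in> borel_measurable borel" by (rule borel_measurable_continuous_onI[OF f_cont])
  obtain C where C: "\<And>y. \<bar>f y\<bar> \<le> C" using C0_bounded[OF f] by blast
  have "0 \<le> C" using C[of undefined] by linarith
  obtain \<rho> t0 where far': "0 < t0" "\<And>z t. \<rho> \<le> norm z \<Longrightarrow> 0 \<le> t \<Longrightarrow> t \<le> t0 \<Longrightarrow> \<bar>transition f t z\<bar> \<le> \<epsilon> / 4"
    using far[of "\<epsilon> / 4"] \<epsilon> by auto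
  obtain \<rho>' where f_far: "\<And>z. \<rho>' \<le> norm z \<Longrightarrow> \<bar>f z\<bar> < \<epsilon> / 4"
    using C0_small_outside_ball[OF f, of "\<epsilon> / 4"] \<epsilon> by auto
  define r where "r = max \<rho> \<rho>'"
  obtain B D where D: "0 \<le> B" "rate_domain B D"
      "\<And>s z. 0 \<le> s \<Longrightarrow> s \<le> 1 \<Longrightarrow> norm z \<le> r \<Longrightarrow> D s z"
    using rates unfolding locally_bounded_rates_def by blast
  have "uniformly_continuous_on ({0..1} \<times> cball 0 r) (\<lambda>p. f ((\<lambda>(t, z). \<phi> t z) p))"
    by (intro compact_uniformly_continuous compact_Times compact_Icc compact_cball
        continuous_on_compose2[OF f_cont] continuous_on_subset[OF continuous_on_flow]) auto
  then obtain \<delta> where \<delta>: "0 < \<delta>" "\<And>p q. p \<in> {0..1} \<times> cball 0 r \<Longrightarrow> q \<in> {0..1} \<times> cball 0 r \<Longrightarrow> dist p q < \<delta>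
      \<Longrightarrow> dist (f ((\<lambda>(t, z). \<phi> t z) p)) (f ((\<lambda>(t, z). \<phi> t z) q)) < \<epsilon> / 4"
    unfolding uniformly_continuous_on_def using \<epsilon> by (metis zero_less_divide_iff zero_less_numeral)
  have "((\<lambda>t. 2 * C * B * t) \<longlongrightarrow> 2 * C * B * 0) (at_right 0)" by (intro tendsto_intros)
  from order_tendstoD(2)[OF this, of "\<epsilon> / 4"] \<epsilon>
  have small: "\<forall>\<^sub>F t in at_right 0. 2 * C * B * t < \<epsilon> / 4" by simp
  have "\<forall>\<^sub>F t in at_right 0. t \<in> {0<..<min 1 (min \<delta> t0)}"
    using far'(1) \<delta>(1) by (intro eventually_at_right_real) auto
  with small show "\<forall>\<^sub>F t in at_right 0. dist (SUP z. \<bar>transition f t z - f z\<bar>) 0 < \<epsilon>"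
  proof eventually_elim
    case (elim t)
    then have t: "0 \<le> t" "t \<le> 1" "t < \<delta>" "t \<le> t0" by auto
    have "\<bar>transition f t z - f z\<bar> \<le> \<epsilon> / 2" for z
    proof (cases "r \<le> norm z")
      case True
      then show ?thesis using far'(2)[of z t] f_far[of z] t unfolding r_def by (auto simp: abs_if split: if_splits)
    next
      case False
      then have z: "norm z \<le> r" by simp
      have "\<bar>transition f t z - f (\<phi> t z)\<bar> \<le> 2 * C * B * t"
        by (rule transition_near_flow[OF f_meas C t(1) D(2) D(3)]) (use t z in auto)
      moreover have "\<bar>f (\<phi> t z) - f z\<bar> < \<epsilon> / 4"
        using \<delta>(2)[of "(t, z)" "(0, z)"] t z by (simp add: dist_Pair_Pair dist_real_def)
      ultimately show ?thesis using elim(1) by linarith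
    qed
    then have "\<bar>SUP z. \<bar>transition f t z - f z\<bar>\<bar> \<le> \<epsilon> / 2"
      by (intro cSup_abs_le) auto
    then show ?case using \<epsilon> by (simp add: dist_real_def)
  qed
qed

end

section \<open>Behaviour at infinity and the Feller property\<close>

context pdmp
begin

lemma flow_escapes:
  assumes "\<forall>t>0. filterlim (\<lambda>z. INF s\<in>{0..t}. norm (\<phi> s z)) at_top at_infinity"
    and "0 \<le> s"
  shows "filterlim (\<phi> s) at_infinity at_infinity"
proof -
  have "filterlim (\<lambda>z. norm (\<phi> s z)) at_top at_infinity"
  proof (rule filterlim_at_top_mono)
    show "filterlim (\<lambda>z. INF r\<in>{0..s + 1}. norm (\<phi> r z)) at_top at_infinity"
      using assms by simp
    show "\<forall>\<^sub>F z in at_infinity. (INF r\<in>{0..s + 1}. norm (\<phi> r z)) \<le> norm (\<phi> s z)"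
      by (intro always_eventually allI cINF_lower) (use assms(2) in \<open>auto intro!: bdd_belowI2[where m = 0]\<close>)
  qed
  then show ?thesis by (simp add: filterlim_at_infinity_conv_norm_at_top)
qed

context
  assumes bounded: "bounded_rate_condition \<phi> lam (space Xi) R"
begin

lemma bounded_rate_domain:
  obtains B where "0 \<le> B" "\<And>y. lam y \<le> B" "rate_domain B (\<lambda>_ _. True)"
proof -
  obtain B where B: "\<And>y. \<bar>lam y\<bar> \<le> B"
    using bounded unfolding bounded_rate_condition_def bounded_iff by auto
  then have "lam y \<le> B" for y by (meson abs_le_D1)
  moreover have "0 \<le> B" using B[of undefined] by linarith
  ultimately show thesis by (intro that) (auto simp: rate_domain_def)
qed

lemma locally_bounded_rates_if_bounded: locally_bounded_rates
proof -
  obtain B where "0 \<le> B" "rate_domain B (\<lambda>_ _. True)" using bounded_rate_domain by blast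
  then show ?thesis unfolding locally_bounded_rates_def by (intro allI exI[of _ B] exI[of _ "\<lambda>_ _. True"]) simp
qed

lemma transition_vanishes_if_bounded:
  assumes f: "f \<in> C0" and t: "0 \<le> t"
  shows "(transition f t \<longlongrightarrow> 0) at_infinity"
proof (rule tendsto_at_infinity_sequentiallyI)
  fix zs :: "nat \<Rightarrow> 'a" assume zs: "filterlim zs at_infinity sequentially"
  have f_cont: "continuous_on UNIV f" and f_lim: "(f \<longlongrightarrow> 0) at_infinity" using f by (auto simp: C0_def)
  have f_meas: "f \<in> borel_measurable borel" by (rule borel_measurable_continuous_onI[OF f_cont])
  obtain C where C: "\<And>y. \<bar>f y\<bar> \<le> C" using C0_bounded[OF f] by blast
  have "0 \<le> C" using C[of undefined] by linarith
  then have c: "\<bar>0\<bar> \<le> C" by simp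
  obtain B where B: "\<And>y. lam y \<le> B" "rate_domain B (\<lambda>_ _. True)" using bounded_rate_domain by blast
  show "(\<lambda>m. transition f t (zs m)) \<longlonglongrightarrow> 0"
  proof (rule tendstoI)
    fix \<epsilon> :: real assume "0 < \<epsilon>"
    then have \<epsilon>: "0 < \<epsilon> / 2" by simp
    obtain n where n: "2 * C * ((B * t) ^ n / fact n) < \<epsilon> / 2"
      using order_tendstoD(2)[OF truncation_error_tendsto \<epsilon>, of C "B * t"]
      by (auto simp: eventually_sequentially)
    have "(\<lambda>m. truncated_expectation f 0 n t (zs m)) \<longlonglongrightarrow> 0"
      by (rule truncated_expectation_vanishes[OF f_cont C f_lim B(1) _ _ t zs])
        (use bounded flow_escapes in \<open>auto simp: bounded_rate_condition_def filterlim_at_infinity_conv_norm_at_top\<close>)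
    from tendstoD[OF this \<epsilon>] show "\<forall>\<^sub>F m in sequentially. dist (transition f t (zs m)) 0 < \<epsilon>"
    proof eventually_elim
      case (elim m)
      then show ?case
        using n transition_truncation_error_on_domain[OF f_meas C c t B(2), of "zs m" n]
        by (simp add: dist_real_def)
    qed
  qed
qed

text \<open>For short times a jump is unlikely uniformly in the start point, and the flow alone does not
  return from far out.\<close>

lemma transition_small_far_out_if_bounded:
  assumes f: "f \<in> C0" and \<epsilon>: "0 < \<epsilon>"
  shows "\<exists>\<rho> t0. 0 < t0 \<and> (\<forall>z t. \<rho> \<le> norm z \<longrightarrow> 0 \<le> t \<longrightarrow> t \<le> t0 \<longrightarrow> \<bar>transition f t z\<bar> \<le> \<epsilon>)"
proof -
  have f_meas: "f \<in> borel_measurable borel"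
    using f by (intro borel_measurable_continuous_onI) (simp add: C0_def)
  obtain C where C: "\<And>y. \<bar>f y\<bar> \<le> C" using C0_bounded[OF f] by blast
  have "0 \<le> C" using C[of undefined] by linarith
  obtain B where B: "0 \<le> B" "rate_domain B (\<lambda>_ _. True)" using bounded_rate_domain by blast
  obtain r where r: "\<And>y. r \<le> norm y \<Longrightarrow> \<bar>f y\<bar> < \<epsilon> / 2"
    using C0_small_outside_ball[OF f, of "\<epsilon> / 2"] \<epsilon> by auto
  have "\<forall>\<^sub>F z in at_infinity. r \<le> (INF s\<in>{0..1}. norm (\<phi> s z))"
    using bounded unfolding bounded_rate_condition_def filterlim_at_top by simp
  then obtain \<rho> where \<rho>: "\<And>z. \<rho> \<le> norm z \<Longrightarrow> r \<le> (INF s\<in>{0..1}. norm (\<phi> s z))"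
    by (auto simp: eventually_at_infinity)
  \<comment> \<open>The horizon \<open>1\<close> is the one for which \<open>\<rho>\<close> was chosen; the other term makes the jump
    probability small, with \<open>+ 1\<close> guarding against a zero denominator.\<close>
  define t0 where "t0 = min 1 (\<epsilon> / (2 * (2 * C * B + 1)))"
  have "0 < t0" using \<epsilon> \<open>0 \<le> C\<close> B(1) by (simp add: t0_def add_nonneg_pos)
  moreover have "\<bar>transition f t z\<bar> \<le> \<epsilon>" if z: "\<rho> \<le> norm z" and t: "0 \<le> t" "t \<le> t0" for z t
  proof -
    have "(INF s\<in>{0..1}. norm (\<phi> s z)) \<le> norm (\<phi> t z)"
      by (rule cINF_lower) (use t in \<open>auto simp: t0_def intro!: bdd_belowI2[where m = 0]\<close>)
    then have "\<bar>f (\<phi> t z)\<bar> < \<epsilon> / 2" using \<rho>[OF z] by (intro r) simp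
    moreover have "\<bar>transition f t z - f (\<phi> t z)\<bar> \<le> 2 * C * B * t"
      by (rule transition_near_flow[OF f_meas C t(1) B(2) TrueI])
    moreover have "2 * C * B * t \<le> \<epsilon> / 2"
    proof -
      have "2 * C * B * t \<le> (2 * C * B + 1) * (\<epsilon> / (2 * (2 * C * B + 1)))"
        using t \<open>0 \<le> C\<close> B(1) by (intro mult_mono) (auto simp: t0_def)
      also have "\<dots> = \<epsilon> / 2"
      proof -
        have "2 * C * B + 1 > 0" using \<open>0 \<le> C\<close> B(1) by (simp add: add_nonneg_pos)
        then show ?thesis by (simp add: divide_simps)
      qed
      finally show ?thesis .
    qed
    ultimately show ?thesis by linarith
  qed
  ultimately show ?thesis by blast
qed

end

context
  assumes preserving: "norm_preserving_condition \<phi> (space Xi) R"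
begin

lemma energy_R: "\<xi> \<in> space Xi \<Longrightarrow> energy (R z \<xi>) = energy z"
  using preserving by (simp add: norm_preserving_condition_def energy_def)

text \<open>The energy grows at most exponentially along the flow and is unchanged by jumps. Weighting it by
  the exponential of the remaining time gives an invariant sublevel set, on which the rate is bounded
  by compactness.\<close>

lemma locally_bounded_rates_if_preserving: locally_bounded_rates
  unfolding locally_bounded_rates_def
proof (intro allI)
  fix r t :: real
  define m where "m = exp (growth_rate * t) * (r\<^sup>2 + (norm (g 0))\<^sup>2)"
  define D where "D = (\<lambda>s z. 0 \<le> s \<and> exp (growth_rate * s) * energy z \<le> m)"
  have "compact (lam ` cball 0 (sqrt m))"
    by (intro compact_continuous_image continuous_on_subset[OF lam_cont]) auto
  from compact_imp_bounded[OF this] obtain b where b: "\<forall>x\<in>lam ` cball 0 (sqrt m). norm x \<le> b"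
    unfolding bounded_iff by blast
  have lam_b: "lam y \<le> max 0 b" if "energy y \<le> m" for y
  proof -
    have "(norm y)\<^sup>2 \<le> m" using that by (simp add: energy_def) (smt (verit) zero_le_power2)
    then have "norm y \<le> sqrt m" by (rule real_le_rsqrt)
    then have "norm (lam y) \<le> b" using b by simp
    then show ?thesis by simp
  qed
  have "rate_domain (max 0 b) D"
    unfolding rate_domain_def
  proof (intro allI impI ballI)
    fix u z s assume D: "D u z" and "s \<in> {0..u}"
    then have s: "0 \<le> s" "s \<le> u" by auto
    have "energy (\<phi> s z) \<le> exp (growth_rate * s) * energy z"
      using energy_flow_le[of 0 s z] s by simp
    then have "exp (growth_rate * (u - s)) * energy (\<phi> s z)
        \<le> exp (growth_rate * (u - s)) * (exp (growth_rate * s) * energy z)"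
      by (intro mult_left_mono) auto
    also have "\<dots> = exp (growth_rate * u) * energy z"
      by (simp only: mult.assoc[symmetric] exp_add[symmetric]) (simp add: algebra_simps)
    also have "\<dots> \<le> m" using D by (simp add: D_def)
    finally have bound: "exp (growth_rate * (u - s)) * energy (\<phi> s z) \<le> m" .
    have "1 * energy (\<phi> s z) \<le> exp (growth_rate * (u - s)) * energy (\<phi> s z)"
      using s growth_rate_pos by (intro mult_right_mono energy_nonneg) auto
    with bound have "energy (\<phi> s z) \<le> m" by simp
    then show "lam (\<phi> s z) \<le> max 0 b \<and> (\<forall>\<xi>\<in>space Xi. D (u - s) (R (\<phi> s z) \<xi>))"
      using bound s by (auto simp: D_def energy_R intro!: lam_b)
  qed
  moreover have "D s z" if "0 \<le> s" "s \<le> t" "norm z \<le> r" for s z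
  proof -
    have "(norm z)\<^sup>2 \<le> r\<^sup>2" using that by (intro power_mono) auto
    then show ?thesis
      unfolding D_def m_def energy_def using that growth_rate_pos
      by (auto intro!: mult_mono)
  qed
  ultimately show "\<exists>B D. 0 \<le> B \<and> rate_domain B D \<and>
      (\<forall>s z. 0 \<le> s \<longrightarrow> s \<le> t \<longrightarrow> norm z \<le> r \<longrightarrow> D s z)"
    by (intro exI[of _ "max 0 b"] exI[of _ D]) auto
qed

text \<open>A path is prolonged by letting its last flow segment run longer.\<close>

lemma reachable_extend:
  assumes "pdmp_reachable \<phi> R S t z y" "0 \<le> \<delta>"
  shows "\<exists>y'. pdmp_reachable \<phi> R S (t + \<delta>) z y' \<and> energy y' \<le> exp (growth_rate * \<delta>) * energy y"
  using assms
proof induction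
  case (flow t z)
  then show ?case
    using energy_flow_le[of t "t + \<delta>" z]
    by (intro exI[of _ "\<phi> (t + \<delta>) z"]) (auto intro!: pdmp_reachable.flow)
next
  case (jump s \<xi> t z y)
  then obtain y' where "pdmp_reachable \<phi> R S (t + \<delta>) (R (\<phi> s z) \<xi>) y'"
      "energy y' \<le> exp (growth_rate * \<delta>) * energy y" by auto
  then show ?case
    using pdmp_reachable.jump[OF jump.hyps(1,2), of \<phi> R "t + \<delta>" z y']
    by (auto simp: add.assoc)
qed

text \<open>The growth condition concerns paths of one fixed duration \<open>t0\<close>, while strong continuity
  requires uniformity over shorter durations. A short path that returns to a ball could be prolonged
  to duration \<open>t0\<close> without leaving a larger ball, which the condition for
  \<open>t0\<close> forbids.\<close>

lemma reachable_far_out: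
  assumes "0 < t0"
  obtains \<rho> where "\<And>z t y. \<rho> \<le> norm z \<Longrightarrow> 0 \<le> t \<Longrightarrow> t \<le> t0 \<Longrightarrow>
    pdmp_reachable \<phi> R (space Xi) t z y \<Longrightarrow> r \<le> norm y"
proof -
  define m where "m = exp (growth_rate * t0) * (r\<^sup>2 + (norm (g 0))\<^sup>2)"
  define P where "P = (\<lambda>z. {norm (pdmp_path \<phi> R \<tau> \<xi> k z) | k \<tau> \<xi>.
     (\<forall>i\<le>k. 0 \<le> \<tau> i) \<and> (\<Sum>i\<le>k. \<tau> i) = t0 \<and> (\<forall>i\<in>{1..k}. \<xi> i \<in> space Xi)})"
  have "filterlim (\<lambda>z. Inf (P z)) at_top at_infinity"
    using preserving assms unfolding norm_preserving_condition_def P_def by blast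
  then have "\<forall>\<^sub>F z in at_infinity. sqrt m + 1 \<le> Inf (P z)"
    unfolding filterlim_at_top by blast
  then obtain \<rho> where \<rho>: "\<And>z. \<rho> \<le> norm z \<Longrightarrow> sqrt m + 1 \<le> Inf (P z)"
    by (auto simp: eventually_at_infinity)
  have "r \<le> norm y" if z: "\<rho> \<le> norm z" and t: "0 \<le> t" "t \<le> t0"
    and y: "pdmp_reachable \<phi> R (space Xi) t z y" for z t y
  proof (rule ccontr)
    assume "\<not> r \<le> norm y"
    then have "(norm y)\<^sup>2 \<le> r\<^sup>2" by (intro power_mono) auto
    obtain y' where y': "pdmp_reachable \<phi> R (space Xi) t0 z y'"
        "energy y' \<le> exp (growth_rate * (t0 - t)) * energy y"
      using reachable_extend[OF y, of "t0 - t"] t by auto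
    have "\<dots> \<le> m"
      unfolding m_def energy_def using \<open>(norm y)\<^sup>2 \<le> r\<^sup>2\<close> t growth_rate_pos
      by (intro mult_mono) auto
    with y'(2) have "(norm y')\<^sup>2 \<le> m" by (simp add: energy_def) (smt (verit) zero_le_power2)
    then have "norm y' \<le> sqrt m" by (rule real_le_rsqrt)
    moreover have "norm y' \<in> P z"
      using pdmp_reachable_path[OF y'(1)] unfolding P_def by blast
    then have "Inf (P z) \<le> norm y'"
      by (intro cInf_lower) (auto simp: P_def intro!: bdd_belowI[where m = 0])
    ultimately show False using \<rho>[OF z] by linarith
  qed
  then show thesis by (rule that)
qed

text \<open>As long as fewer than \<open>n\<close> jumps happen, the state is reachable in the sense above and the
  bound on \<open>f\<close> far out applies path by path. The remaining paths contribute \<open>0\<close> to the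
  truncation, and the truncation error vanishes as \<open>n\<close> grows.\<close>

lemma transition_small_far_out_if_preserving:
  assumes f: "f \<in> C0" and \<epsilon>: "0 < \<epsilon>" and t0: "0 < t0"
  shows "\<exists>\<rho>. \<forall>z t. \<rho> \<le> norm z \<longrightarrow> 0 \<le> t \<longrightarrow> t \<le> t0 \<longrightarrow> \<bar>transition f t z\<bar> \<le> \<epsilon>"
proof -
  have f_meas [measurable]: "f \<in> borel_measurable borel"
    using f by (intro borel_measurable_continuous_onI) (simp add: C0_def)
  obtain C where C: "\<And>y. \<bar>f y\<bar> \<le> C" using C0_bounded[OF f] by blast
  have "0 \<le> C" using C[of undefined] by linarith
  then have c: "\<bar>0\<bar> \<le> C" by simp
  obtain r where r: "\<And>y. r \<le> norm y \<Longrightarrow> \<bar>f y\<bar> < \<epsilon>"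
    using C0_small_outside_ball[OF f \<epsilon>] by blast
  obtain \<rho> where \<rho>: "\<And>z t y. \<rho> \<le> norm z \<Longrightarrow> 0 \<le> t \<Longrightarrow> t \<le> t0 \<Longrightarrow>
      pdmp_reachable \<phi> R (space Xi) t z y \<Longrightarrow> r \<le> norm y"
    using reachable_far_out[OF t0] by blast
  have "\<bar>transition f t z\<bar> \<le> \<epsilon>" if z: "\<rho> \<le> norm z" and t: "0 \<le> t" "t \<le> t0" for z t
  proof -
    obtain B D where D: "rate_domain B D" "D t z"
      using locally_bounded_rates_if_preserving t
      unfolding locally_bounded_rates_def by (meson order_refl)
    have "\<bar>truncated_expectation f 0 n t z\<bar> \<le> \<epsilon>" for n
      unfolding truncated_expectation_def
    proof (rule marks.P.abs_expectation_le)
      fix \<omega> assume "\<omega> \<in> space marks"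
      then have marks_in: "snd (\<omega> k) \<in> space Xi" for k
        by (auto simp: space_PiM PiE_iff space_pair_measure mem_Times_iff)
      from truncated_reachable[OF t(1), of \<omega> "space Xi" \<phi> W R f 0 n z, OF marks_in]
      show "\<bar>truncated \<psi> W R f 0 n t z \<omega>\<bar> \<le> \<epsilon>"
        unfolding truncated_forward[OF t(1)] using r[OF \<rho>[OF z t]] \<epsilon> by force
    qed measurable
    then have "\<bar>transition f t z\<bar> \<le> \<epsilon> + 2 * C * ((B * t) ^ n / fact n)" for n
      using transition_truncation_error_on_domain[OF f_meas C c t(1) D, of n]
      by (smt (verit))
    moreover have "(\<lambda>n. \<epsilon> + 2 * C * ((B * t) ^ n / fact n)) \<longlonglongrightarrow> \<epsilon> + 0"
      by (intro tendsto_add tendsto_const truncation_error_tendsto)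
    ultimately show ?thesis
      by (intro LIMSEQ_le_const[where X = "\<lambda>n. \<epsilon> + 2 * C * ((B * t) ^ n / fact n)"]) auto
  qed
  then show ?thesis by blast
qed

lemma transition_vanishes_if_preserving:
  assumes f: "f \<in> C0" and t: "0 \<le> t"
  shows "(transition f t \<longlongrightarrow> 0) at_infinity"
proof (rule tendstoI)
  fix \<epsilon> :: real assume "0 < \<epsilon>"
  then obtain \<rho> where "\<And>z s. \<rho> \<le> norm z \<Longrightarrow> 0 \<le> s \<Longrightarrow> s \<le> t + 1 \<Longrightarrow> \<bar>transition f s z\<bar> \<le> \<epsilon> / 2"
    using transition_small_far_out_if_preserving[OF f, of "\<epsilon> / 2" "t + 1"] t by auto
  then have "\<And>z. \<rho> \<le> norm z \<Longrightarrow> \<bar>transition f t z\<bar> \<le> \<epsilon> / 2" using t by simp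
  then show "\<forall>\<^sub>F z in at_infinity. dist (transition f t z) 0 < \<epsilon>"
    using \<open>0 < \<epsilon>\<close> unfolding eventually_at_infinity by (force simp: dist_real_def)
qed

end

lemma transition_feller:
  assumes "bounded_rate_condition \<phi> lam (space Xi) R \<or> norm_preserving_condition \<phi> (space Xi) R"
  shows "\<forall>t\<ge>0. \<forall>f\<in>C0. transition f t \<in> C0"
    and "\<forall>f\<in>C0. ((\<lambda>t. SUP z. \<bar>transition f t z - f z\<bar>) \<longlongrightarrow> 0) (at_right 0)"
proof -
  have rates: locally_bounded_rates
    using assms locally_bounded_rates_if_bounded locally_bounded_rates_if_preserving by blast
  show "\<forall>t\<ge>0. \<forall>f\<in>C0. transition f t \<in> C0"
  proof (intro allI impI ballI)
    fix t :: real and f :: "'a \<Rightarrow> real" assume t: "0 \<le> t" and f: "f \<in> C0"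
    obtain C where "\<And>y. \<bar>f y\<bar> \<le> C" using C0_bounded[OF f] by blast
    then have "continuous_on UNIV (transition f t)"
      using f by (intro transition_continuous[OF rates _ _ t]) (auto simp: C0_def)
    moreover have "(transition f t \<longlongrightarrow> 0) at_infinity"
      using assms transition_vanishes_if_bounded[OF _ f t] transition_vanishes_if_preserving[OF _ f t] by blast
    ultimately show "transition f t \<in> C0" by (simp add: C0_def)
  qed
  show "\<forall>f\<in>C0. ((\<lambda>t. SUP z. \<bar>transition f t z - f z\<bar>) \<longlongrightarrow> 0) (at_right 0)"
  proof (intro ballI strongly_continuous[OF rates])
    fix f :: "'a \<Rightarrow> real" and \<epsilon> :: real assume f: "f \<in> C0" and \<epsilon>: "0 < \<epsilon>"
    show "\<exists>\<rho> t0. 0 < t0 \<and> (\<forall>z t. \<rho> \<le> norm z \<longrightarrow> 0 \<le> t \<longrightarrow> t \<le> t0 \<longrightarrow> \<bar>transition f t z\<bar> \<le> \<epsilon>)"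
      using assms
    proof
      assume "bounded_rate_condition \<phi> lam (space Xi) R"
      then show ?thesis by (rule transition_small_far_out_if_bounded[OF _ f \<epsilon>])
    next
      assume "norm_preserving_condition \<phi> (space Xi) R"
      from transition_small_far_out_if_preserving[OF this f \<epsilon> zero_less_one] show ?thesis
        using zero_less_one by blast
    qed
  qed
qed

end

theorem proposition4p2:
  fixes g :: "'a::euclidean_space \<Rightarrow> 'a"
    and \<phi> :: "real \<Rightarrow> 'a \<Rightarrow> 'a"
    and lam :: "'a \<Rightarrow> real"
    and Xi :: "'s measure"
    and R :: "'a \<Rightarrow> 's \<Rightarrow> 'a"
    and \<mu> :: "'a \<Rightarrow> ennreal measure"
    and W :: "'a \<Rightarrow> real \<Rightarrow> ennreal"
    and M :: "'w measure"
    and U :: "nat \<Rightarrow> 'w \<Rightarrow> real"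
    and X :: "nat \<Rightarrow> 'w \<Rightarrow> 's"
  assumes g_C1: "C1_map g"
    and flow: "is_flow g \<phi>"
    and lam_cont: "continuous_on UNIV lam"
    and lam_nonneg: "\<And>z. 0 \<le> lam z"
    and Xi: "prob_space Xi"
    and R_meas: "(\<lambda>(z, \<xi>). R z \<xi>) \<in> borel \<Otimes>\<^sub>M Xi \<rightarrow>\<^sub>M borel"
    and R_cont: "\<And>z. 0 < lam z \<Longrightarrow> AE \<xi> in Xi. isCont (\<lambda>y. R y \<xi>) z"
    and mu: "\<And>z. is_waiting_law \<phi> lam z (\<mu> z)"
    and W_meas: "(\<lambda>(z, u). W z u) \<in> borel \<Otimes>\<^sub>M unif01 \<rightarrow>\<^sub>M borel"
    and W_law: "\<And>z. distr unif01 borel (W z) = \<mu> z"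
    and M: "prob_space M"
    and U_meas: "\<And>k. U k \<in> M \<rightarrow>\<^sub>M unif01"
    and U_law: "\<And>k. distr M unif01 (U k) = unif01"
    and X_meas: "\<And>k. X k \<in> M \<rightarrow>\<^sub>M Xi"
    and X_law: "\<And>k. distr M Xi (X k) = Xi"
    and indep:
      "prob_space.indep_sets M
         (case_sum (\<lambda>k. {U k -` A \<inter> space M | A. A \<in> sets unif01})
                   (\<lambda>k. {X k -` A \<inter> space M | A. A \<in> sets Xi})) (UNIV :: (nat + nat) set)"
    and g_lipschitz: "\<exists>L>0. \<forall>x y. norm (g x - g y) \<le> L * norm (x - y)"
    and growth:
      "bounded_rate_condition \<phi> lam (space Xi) R \<or> norm_preserving_condition \<phi> (space Xi) R"
  shows "(\<forall>t\<ge>0. \<forall>f\<in>C0. pdmp_semigroup \<phi> W R M U X t f \<in> C0) \<and>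
         (\<forall>f\<in>C0. ((\<lambda>t. SUP z. \<bar>pdmp_semigroup \<phi> W R M U X t f z - f z\<bar>) \<longlongrightarrow> 0) (at_right 0))"
proof -
  obtain L where "0 < L" "\<And>x y. norm (g x - g y) \<le> L * norm (x - y)"
    using g_lipschitz by blast
  then interpret pdmp g \<phi> L Xi lam R \<mu> W
    using flow lam_cont lam_nonneg Xi R_meas R_cont mu W_meas W_law
    by (intro pdmp.intro lipschitz_flow.intro pdmp_axioms.intro) auto
  note [measurable] = U_meas X_meas
  have law: "distr M marks (\<lambda>\<omega> k. (U k \<omega>, X k \<omega>)) = marks"
    by (rule iid_pair_sequence_law[OF M U_meas U_law X_meas X_law indep])
  have semigroup: "pdmp_semigroup \<phi> W R M U X t f z = transition f t z"
    if t: "0 \<le> t" and f: "f \<in> C0" for t f z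
  proof -
    note [measurable] = canonical_state_measurable[OF t]
    have [measurable]: "f \<in> borel_measurable borel"
      using f by (intro borel_measurable_continuous_onI) (simp add: C0_def)
    have [measurable]: "(\<lambda>\<omega> k. (U k \<omega>, X k \<omega>)) \<in> M \<rightarrow>\<^sub>M marks"
    proof (rule measurable_PiM_single')
      show "(\<lambda>\<omega>. (U k \<omega>, X k \<omega>)) \<in> M \<rightarrow>\<^sub>M unif01 \<Otimes>\<^sub>M Xi" for k
        by (rule measurable_Pair[OF U_meas X_meas])
      from measurable_space[OF this]
      show "(\<lambda>\<omega> k. (U k \<omega>, X k \<omega>)) \<in> space M \<rightarrow> (\<Pi>\<^sub>E k\<in>UNIV. space (unif01 \<Otimes>\<^sub>M Xi))"
        unfolding PiE_UNIV_domain by blast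
    qed
    have "transition f t z = (\<integral>\<omega>. f (canonical_state t z \<omega>) \<partial>distr M marks (\<lambda>\<omega> k. (U k \<omega>, X k \<omega>)))"
      unfolding law transition_def ..
    also have "\<dots> = (\<integral>\<omega>. f (canonical_state t z (\<lambda>k. (U k \<omega>, X k \<omega>))) \<partial>M)"
      by (rule integral_distr) measurable
    finally show ?thesis by (simp add: pdmp_semigroup_def canonical_state_def)
  qed
  have "pdmp_semigroup \<phi> W R M U X t f \<in> C0" if "0 \<le> t" "f \<in> C0" for t f
  proof -
    have "pdmp_semigroup \<phi> W R M U X t f = transition f t"
      using semigroup[OF that] by (intro ext)
    then show ?thesis using transition_feller(1)[OF growth] that by simp
  qed
  moreover have "((\<lambda>t. SUP z. \<bar>pdmp_semigroup \<phi> W R M U X t f z - f z\<bar>) \<longlongrightarrow> 0) (at_right 0)"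
    if f: "f \<in> C0" for f
  proof (rule Lim_transform_eventually)
    show "((\<lambda>t. SUP z. \<bar>transition f t z - f z\<bar>) \<longlongrightarrow> 0) (at_right 0)"
      using transition_feller(2)[OF growth] f by blast
    show "\<forall>\<^sub>F t in at_right 0. (SUP z. \<bar>transition f t z - f z\<bar>)
        = (SUP z. \<bar>pdmp_semigroup \<phi> W R M U X t f z - f z\<bar>)"
      using eventually_at_right_less[of "0 :: real"]
      by eventually_elim (simp add: semigroup f)
  qed
  ultimately show ?thesis by blast
qed

end
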